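(* A Banach lattice $X$ has the lattice-lifting property if and only if $X$ is lattice isomorphic to a lattice-complemented sublattice of $FBL[X]$.
   Context: All Banach spaces are real; $B_E$ is the closed unit ball of $E$. A lattice homomorphism between Banach lattices is a bounded linear operator preserving lattice operations. A sublattice means a closed vector sublattice. A sublattice $Y$ of a Banach lattice $Z$ is lattice-complemented if there is a lattice homomorphism $P:Z\to Y$ with $P|_Y=id_Y$. Free Banach lattice: for a Banach space $E$ and a positively homogeneous function $f:E^*\to\mathbb{R}$ (i.e. $f(\lambda x^* )=\lambda f(x^* )$ for $\lambda>0$), put $\|f\|_{FBL[E]}:=\sup\{\sum_{i=1}^n|f(x_i^* )|: n\in\mathbb{N},\ x_1^*,\dots,x_n^*\in E^*,\ \sup_{x\in B_E}\sum_{i=1}^n|x_i^*(x)|\le 1\}\in[0,\infty]$. Let $H_0[E]$ be the Banach lattice of all positively homogeneous $f$ with $\|f\|_{FBL[E]}<\infty$, with this norm and the pointwise order. $FBL[E]$ is the (closed) sublattice of $H_0[E]$ generated by $\{\delta_E(x):x\in E\}$, where $\delta_E(x)(x^* ):=x^*(x)$. The map $\delta_E:E\to FBL[E]$ is a linear isometry, and for every Banach lattice $X$ and bounded linear $T:E\to X$ there is a unique lattice homomorphism $\hat T:FBL[E]\to X$ with $\hat T\circ\delta_E=T$; moreover $\|\hat T\|=\|T\|$. For a Banach lattice $X$, $\beta_X:FBL[X]\to X$ is the unique lattice homomorphism with $\beta_X\circ\delta_X=id_X$. A Banach lattice $X$ has the lattice-lifting property if there is a lattice homomorphism $T:X\to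 FBL[X]$ with $\beta_X\circ T=id_X$. *)

theory Defs
  imports "HOL-Analysis.Analysis" "HOL-Library.Lattice_Algebras"
begin

section \<open>Banach lattices\<close>

text \<open>The class \<open>lattice_ab_group_add_abs\<close> fixes the modulus as \<open>\<bar>x\<bar> = sup x (- x)\<close>.\<close>

class banach_lattice = banach + ordered_real_vector + lattice_ab_group_add_abs +
  assumes norm_lattice_mono: "\<bar>x\<bar> \<le> \<bar>y\<bar> \<Longrightarrow> norm x \<le> norm y"

definition lattice_hom :: "('a::banach_lattice \<Rightarrow> 'b::banach_lattice) \<Rightarrow> bool" where
  "lattice_hom T \<longleftrightarrow> bounded_linear T \<and>
     (\<forall>x y. T (sup x y) = sup (T x) (T y)) \<and> (\<forall>x y. T (inf x y) = inf (T x) (T y))"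

definition sublattice :: "'a::banach_lattice set \<Rightarrow> bool" where
  "sublattice Y \<longleftrightarrow> subspace Y \<and> closed Y \<and>
     (\<forall>x\<in>Y. \<forall>y\<in>Y. sup x y \<in> Y) \<and> (\<forall>x\<in>Y. \<forall>y\<in>Y. inf x y \<in> Y)"

definition lattice_complemented :: "'a::banach_lattice set \<Rightarrow> bool" where
  "lattice_complemented Y \<longleftrightarrow>
     (\<exists>P::'a \<Rightarrow> 'a. lattice_hom P \<and> range P \<subseteq> Y \<and> (\<forall>y\<in>Y. P y = y))"

text \<open>The whole space \<open>'a\<close> is lattice isomorphic to the sublattice \<open>Y\<close>: there is a lattice
  homomorphism onto \<open>Y\<close> that is a homeomorphism (in particular bijective).  Its inverse \<open>R\<close> is then
  automatically linear and lattice preserving on \<open>Y\<close>, and its continuity is boundedness.\<close>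

definition lattice_isomorphic_onto :: "'a::banach_lattice itself \<Rightarrow> 'b::banach_lattice set \<Rightarrow> bool" where
  "lattice_isomorphic_onto _ Y \<longleftrightarrow>
     (\<exists>(S::'a \<Rightarrow> 'b) R. lattice_hom S \<and> homeomorphism UNIV Y S R)"

section \<open>The Banach lattice \<open>H\<^sub>0[E]\<close>\<close>

text \<open>The dual \<open>E\<^sup>*\<close> is the type \<open>'a \<Rightarrow>\<^sub>L real\<close>; finite families \<open>x\<^sub>1\<^sup>*, \<dots>, x\<^sub>n\<^sup>*\<close> (possibly with
  repetitions) are lists.  The set below is the set of families with
  \<open>sup\<^sub>x \<Sum>\<^sub>i \<bar>x\<^sub>i\<^sup>* x\<bar> \<le> 1\<close>, where \<open>x\<close> ranges over the closed unit ball.\<close>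

definition admissible :: "('a::banach \<Rightarrow>\<^sub>L real) list set" where
  "admissible = {\<phi>s. \<forall>x\<in>cball 0 1. (\<Sum>\<phi>\<leftarrow>\<phi>s. \<bar>blinfun_apply \<phi> x\<bar>) \<le> 1}"

definition FBL_norm :: "(('a::banach \<Rightarrow>\<^sub>L real) \<Rightarrow> real) \<Rightarrow> ennreal" where
  "FBL_norm f = (SUP \<phi>s\<in>admissible. ennreal (\<Sum>\<phi>\<leftarrow>\<phi>s. \<bar>f \<phi>\<bar>))"

definition pos_homogeneous :: "('a::real_vector \<Rightarrow> real) \<Rightarrow> bool" where
  "pos_homogeneous f \<longleftrightarrow> (\<forall>c>0. \<forall>\<phi>. f (c *\<^sub>R \<phi>) = c * f \<phi>)"

lemma FBL_norm_le_iff: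
  "0 \<le> B \<Longrightarrow> FBL_norm f \<le> ennreal B \<longleftrightarrow> (\<forall>\<phi>s\<in>admissible. (\<Sum>\<phi>\<leftarrow>\<phi>s. \<bar>f \<phi>\<bar>) \<le> B)"
  unfolding FBL_norm_def SUP_le_iff by (simp add: ennreal_le_iff)

lemma Nil_admissible: "[] \<in> admissible"
  by (simp add: admissible_def)

lemma FBL_norm_finite_iff:
  "FBL_norm f < top \<longleftrightarrow> (\<exists>B. \<forall>\<phi>s\<in>admissible. (\<Sum>\<phi>\<leftarrow>\<phi>s. \<bar>f \<phi>\<bar>) \<le> B)"
proof
  assume "FBL_norm f < top"
  then have "FBL_norm f \<le> ennreal (enn2real (FBL_norm f))" by simp
  then show "\<exists>B. \<forall>\<phi>s\<in>admissible. (\<Sum>\<phi>\<leftarrow>\<phi>s. \<bar>f \<phi>\<bar>) \<le> B"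
    by (subst (asm) FBL_norm_le_iff) auto
next
  assume "\<exists>B. \<forall>\<phi>s\<in>admissible. (\<Sum>\<phi>\<leftarrow>\<phi>s. \<bar>f \<phi>\<bar>) \<le> B"
  then obtain B where B: "\<forall>\<phi>s\<in>admissible. (\<Sum>\<phi>\<leftarrow>\<phi>s. \<bar>f \<phi>\<bar>) \<le> B" ..
  with Nil_admissible have "0 \<le> B" by force
  with B have "FBL_norm f \<le> ennreal B" by (simp add: FBL_norm_le_iff)
  then show "FBL_norm f < top" using le_less_trans by fastforce
qed

typedef (overloaded) 'a H0 =
  "{f :: ('a::banach \<Rightarrow>\<^sub>L real) \<Rightarrow> real. pos_homogeneous f \<and> FBL_norm f < top}"
  morphisms H0_apply Abs_H0
  by (rule exI[of _ "\<lambda>_. 0"]) (auto simp: pos_homogeneous_def FBL_norm_finite_iff intro: exI[of _ 0])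

setup_lifting type_definition_H0

lemma H0_bound_mono:
  assumes "FBL_norm f < top" "FBL_norm g < top" "\<And>\<phi>. \<bar>h \<phi>\<bar> \<le> \<bar>f \<phi>\<bar> + \<bar>g \<phi>\<bar>"
  shows "FBL_norm h < top"
proof -
  obtain B C where B: "\<forall>\<phi>s\<in>admissible. (\<Sum>\<phi>\<leftarrow>\<phi>s. \<bar>f \<phi>\<bar>) \<le> B"
    and C: "\<forall>\<phi>s\<in>admissible. (\<Sum>\<phi>\<leftarrow>\<phi>s. \<bar>g \<phi>\<bar>) \<le> C"
    using assms(1,2) unfolding FBL_norm_finite_iff by blast
  have "(\<Sum>\<phi>\<leftarrow>\<phi>s. \<bar>h \<phi>\<bar>) \<le> B + C" if "\<phi>s \<in> admissible" for \<phi>s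
  proof -
    have "(\<Sum>\<phi>\<leftarrow>\<phi>s. \<bar>h \<phi>\<bar>) \<le> (\<Sum>\<phi>\<leftarrow>\<phi>s. \<bar>f \<phi>\<bar> + \<bar>g \<phi>\<bar>)"
      by (rule sum_list_mono) (rule assms(3))
    also have "\<dots> \<le> B + C"
      unfolding sum_list_addf using B C that by (intro add_mono) auto
    finally show ?thesis .
  qed
  then show ?thesis unfolding FBL_norm_finite_iff by blast
qed

lemma FBL_norm_scale_finite:
  assumes "FBL_norm f < top"
  shows "FBL_norm (\<lambda>\<phi>. c * f \<phi>) < top"
proof -
  obtain B where B: "\<forall>\<phi>s\<in>admissible. (\<Sum>\<phi>\<leftarrow>\<phi>s. \<bar>f \<phi>\<bar>) \<le> B"
    using assms unfolding FBL_norm_finite_iff by blast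
  have "(\<Sum>\<phi>\<leftarrow>\<phi>s. \<bar>c * f \<phi>\<bar>) \<le> \<bar>c\<bar> * B" if "\<phi>s \<in> admissible" for \<phi>s
    unfolding abs_mult sum_list_const_mult using B that by (intro mult_left_mono) auto
  then show ?thesis unfolding FBL_norm_finite_iff by blast
qed

instantiation H0 :: (banach) "{real_vector, lattice, abs}"
begin

lift_definition zero_H0 :: "'a H0" is "\<lambda>_. 0"
  by (auto simp: pos_homogeneous_def FBL_norm_finite_iff intro: exI[of _ 0])

lift_definition plus_H0 :: "'a H0 \<Rightarrow> 'a H0 \<Rightarrow> 'a H0" is "\<lambda>f g \<phi>. f \<phi> + g \<phi>"
  by (auto simp: pos_homogeneous_def algebra_simps) (erule (1) H0_bound_mono, linarith)

lift_definition minus_H0 :: "'a H0 \<Rightarrow> 'a H0 \<Rightarrow> 'a H0" is "\<lambda>f g \<phi>. f \<phi> - g \<phi>"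
  by (auto simp: pos_homogeneous_def algebra_simps) (erule (1) H0_bound_mono, linarith)

lift_definition uminus_H0 :: "'a H0 \<Rightarrow> 'a H0" is "\<lambda>f \<phi>. - f \<phi>"
  by (auto simp: pos_homogeneous_def FBL_norm_def)

lift_definition scaleR_H0 :: "real \<Rightarrow> 'a H0 \<Rightarrow> 'a H0" is "\<lambda>c f \<phi>. c * f \<phi>"
  by (auto simp: pos_homogeneous_def intro: FBL_norm_scale_finite)

lift_definition less_eq_H0 :: "'a H0 \<Rightarrow> 'a H0 \<Rightarrow> bool" is "\<lambda>f g. \<forall>\<phi>. f \<phi> \<le> g \<phi>" .

definition less_H0 :: "'a H0 \<Rightarrow> 'a H0 \<Rightarrow> bool" where
  "less_H0 f g \<longleftrightarrow> f \<le> g \<and> \<not> g \<le> f"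

lift_definition sup_H0 :: "'a H0 \<Rightarrow> 'a H0 \<Rightarrow> 'a H0" is "\<lambda>f g \<phi>. max (f \<phi>) (g \<phi>)"
  by (auto simp: pos_homogeneous_def max_mult_distrib_left) (erule (1) H0_bound_mono, linarith)

lift_definition inf_H0 :: "'a H0 \<Rightarrow> 'a H0 \<Rightarrow> 'a H0" is "\<lambda>f g \<phi>. min (f \<phi>) (g \<phi>)"
  by (auto simp: pos_homogeneous_def min_mult_distrib_left) (erule (1) H0_bound_mono, linarith)

lift_definition abs_H0 :: "'a H0 \<Rightarrow> 'a H0" is "\<lambda>f \<phi>. \<bar>f \<phi>\<bar>"
  by (auto simp: pos_homogeneous_def FBL_norm_def abs_mult)

instance
proof
  fix f g h :: "'a H0" and c d :: real
  show "f + g + h = f + (g + h)" by transfer (simp add: add.assoc)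
  show "f + g = g + f" by transfer (simp add: add.commute)
  show "0 + f = f" by transfer simp
  show "- f + f = 0" by transfer simp
  show "f - g = f + - g" by transfer simp
  show "c *\<^sub>R (f + g) = c *\<^sub>R f + c *\<^sub>R g" by transfer (simp add: distrib_left)
  show "(c + d) *\<^sub>R f = c *\<^sub>R f + d *\<^sub>R f" by transfer (simp add: distrib_right)
  show "c *\<^sub>R d *\<^sub>R f = (c * d) *\<^sub>R f" by transfer (simp add: mult.assoc)
  show "1 *\<^sub>R f = f" by transfer simp
  show "f < g \<longleftrightarrow> f \<le> g \<and> \<not> g \<le> f" by (rule less_H0_def)
  show "f \<le> f" by transfer simp
  show "f \<le> g \<Longrightarrow> g \<le> h \<Longrightarrow> f \<le> h" by transfer (blast intro: order.trans)
  show "f \<le> g \<Longrightarrow> g \<le> f \<Longrightarrow> f = g" by transfer (simp add: fun_eq_iff order.antisym)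
  show "inf f g \<le> f" "inf f g \<le> g" by (transfer; simp)+
  show "h \<le> f \<Longrightarrow> h \<le> g \<Longrightarrow> h \<le> inf f g" by transfer simp
  show "f \<le> sup f g" "g \<le> sup f g" by (transfer; simp)+
  show "g \<le> f \<Longrightarrow> h \<le> f \<Longrightarrow> sup g h \<le> f" by transfer simp
qed

end

instantiation H0 :: (banach) real_normed_vector
begin

lift_definition norm_H0 :: "'a H0 \<Rightarrow> real" is "\<lambda>f. enn2real (FBL_norm f)" .

definition dist_H0 :: "'a H0 \<Rightarrow> 'a H0 \<Rightarrow> real" where
  "dist_H0 f g = norm (f - g)"

definition sgn_H0 :: "'a H0 \<Rightarrow> 'a H0" where
  "sgn_H0 f = f /\<^sub>R norm f"

definition uniformity_H0 :: "('a H0 \<times> 'a H0) filter" where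
  "uniformity_H0 = (INF e\<in>{0<..}. principal {(x, y). dist x y < e})"

definition open_H0 :: "'a H0 set \<Rightarrow> bool" where
  "open_H0 U \<longleftrightarrow> (\<forall>x\<in>U. \<forall>\<^sub>F (x', y) in uniformity. x' = x \<longrightarrow> y \<in> U)"

lemma H0_norm_le_iff:
  assumes "0 \<le> B"
  shows "norm (f :: 'a H0) \<le> B \<longleftrightarrow> (\<forall>\<phi>s\<in>admissible. (\<Sum>\<phi>\<leftarrow>\<phi>s. \<bar>H0_apply f \<phi>\<bar>) \<le> B)"
proof -
  have "FBL_norm (H0_apply f) < top" using H0_apply[of f] by simp
  then have "FBL_norm (H0_apply f) = ennreal (norm f)" by (simp add: norm_H0.rep_eq)
  then have "norm f \<le> B \<longleftrightarrow> FBL_norm (H0_apply f) \<le> ennreal B"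
    using assms by (simp add: ennreal_le_iff)
  then show ?thesis using assms by (simp add: FBL_norm_le_iff)
qed

lemma H0_norm_nonneg: "0 \<le> norm (f :: 'a H0)"
  by (simp add: norm_H0.rep_eq)

lemma H0_sum_le_norm: "\<phi>s \<in> admissible \<Longrightarrow> (\<Sum>\<phi>\<leftarrow>\<phi>s. \<bar>H0_apply f \<phi>\<bar>) \<le> norm (f :: 'a H0)"
  using H0_norm_le_iff[OF H0_norm_nonneg, of f f] by simp

lemma H0_apply_scale: "0 < c \<Longrightarrow> H0_apply (f :: 'a H0) (c *\<^sub>R \<phi>) = c * H0_apply f \<phi>"
  using H0_apply[of f] by (auto simp: pos_homogeneous_def)

lemma H0_apply_zero: "H0_apply (f :: 'a H0) 0 = 0"
  using H0_apply_scale[of 2 f 0] by simp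

lemma H0_apply_bound: "\<bar>H0_apply (f :: 'a H0) \<phi>\<bar> \<le> norm \<phi> * norm f"
proof (cases "\<phi> = 0")
  case False
  let ?c = "inverse (norm \<phi>)"
  have c: "0 < ?c" using False by simp
  have "\<bar>blinfun_apply (?c *\<^sub>R \<phi>) x\<bar> \<le> 1" if "norm x \<le> 1" for x
  proof -
    have "\<bar>blinfun_apply \<phi> x\<bar> \<le> norm \<phi> * norm x"
      using norm_blinfun[of \<phi> x] by simp
    also have "\<dots> \<le> norm \<phi>" using that by (simp add: mult_left_le)
    finally show ?thesis using False by (simp add: blinfun.scaleR_left abs_mult field_simps)
  qed
  then have "[?c *\<^sub>R \<phi>] \<in> admissible" by (simp add: admissible_def)
  from H0_sum_le_norm[OF this, of f] have "\<bar>H0_apply f (?c *\<^sub>R \<phi>)\<bar> \<le> norm f" by simp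
  then show ?thesis unfolding H0_apply_scale[OF c]
    using False by (simp add: abs_mult field_simps)
qed (simp add: H0_apply_zero)

instance
proof
  fix f g h :: "'a H0" and c d :: real
  show "dist f g = norm (f - g)" by (rule dist_H0_def)
  show "sgn f = f /\<^sub>R norm f" by (rule sgn_H0_def)
  show "uniformity = (INF e\<in>{0<..}. principal {(x, y). dist (x::'a H0) y < e})"
    by (rule uniformity_H0_def)
  show "open U \<longleftrightarrow> (\<forall>x\<in>U. \<forall>\<^sub>F (x', y) in uniformity. x' = x \<longrightarrow> y \<in> U)" for U :: "'a H0 set"
    by (rule open_H0_def)
  show "norm f = 0 \<longleftrightarrow> f = 0"
  proof
    assume "norm f = 0"
    then have "H0_apply f \<phi> = 0" for \<phi> using H0_apply_bound[of f \<phi>] by simp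
    then show "f = 0" by (simp add: H0_apply_inject[symmetric] zero_H0.rep_eq fun_eq_iff)
  next
    assume "f = 0"
    then have "norm f \<le> 0" by (subst H0_norm_le_iff) (auto simp: zero_H0.rep_eq)
    then show "norm f = 0" using H0_norm_nonneg[of f] by simp
  qed
  show "norm (f + g) \<le> norm f + norm g"
  proof (subst H0_norm_le_iff, simp add: H0_norm_nonneg, intro ballI)
    fix \<phi>s :: "('a \<Rightarrow>\<^sub>L real) list" assume a: "\<phi>s \<in> admissible"
    have "(\<Sum>\<phi>\<leftarrow>\<phi>s. \<bar>H0_apply (f + g) \<phi>\<bar>) \<le> (\<Sum>\<phi>\<leftarrow>\<phi>s. \<bar>H0_apply f \<phi>\<bar> + \<bar>H0_apply g \<phi>\<bar>)"
      by (rule sum_list_mono) (simp add: plus_H0.rep_eq)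
    also have "\<dots> \<le> norm f + norm g"
      unfolding sum_list_addf using a by (intro add_mono H0_sum_le_norm)
    finally show "(\<Sum>\<phi>\<leftarrow>\<phi>s. \<bar>H0_apply (f + g) \<phi>\<bar>) \<le> norm f + norm g" .
  qed
  have le: "norm (c *\<^sub>R f) \<le> \<bar>c\<bar> * norm f" for c and f :: "'a H0"
    by (subst H0_norm_le_iff)
      (auto simp: H0_norm_nonneg scaleR_H0.rep_eq abs_mult sum_list_const_mult
        intro!: mult_left_mono H0_sum_le_norm)
  show "norm (c *\<^sub>R f) = \<bar>c\<bar> * norm f"
  proof (cases "c = 0")
    case True
    then show ?thesis using le[of c f] H0_norm_nonneg[of "c *\<^sub>R f"] by simp
  next
    case False
    have "norm f \<le> \<bar>inverse c\<bar> * norm (c *\<^sub>R f)" using le[of "inverse c" "c *\<^sub>R f"] False by simp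
    then have "\<bar>c\<bar> * norm f \<le> norm (c *\<^sub>R f)" using False by (simp add: field_simps)
    with le[of c f] show ?thesis by simp
  qed
qed

end

instance H0 :: (banach) banach
proof
  fix F :: "nat \<Rightarrow> 'a H0"
  assume "Cauchy F"
  then have F: "\<exists>M. \<forall>m\<ge>M. \<forall>n\<ge>M. norm (F m - F n) < e" if "0 < e" for e
    using that by (simp add: Cauchy_def dist_H0_def)
  have pw: "\<bar>H0_apply (F m) \<phi> - H0_apply (F n) \<phi>\<bar> \<le> norm \<phi> * norm (F m - F n)" for m n \<phi>
    using H0_apply_bound[of "F m - F n" \<phi>] by (simp add: minus_H0.rep_eq)
  have "Cauchy (\<lambda>n. H0_apply (F n) \<phi>)" for \<phi>
  proof (rule CauchyI)
    fix e :: real assume e: "0 < e"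
    then have "0 < e / (norm \<phi> + 1)" by (simp add: add_nonneg_pos)
    from F[OF this] obtain M where
      M: "\<And>m n. m \<ge> M \<Longrightarrow> n \<ge> M \<Longrightarrow> norm (F m - F n) < e / (norm \<phi> + 1)" by blast
    have "norm (H0_apply (F m) \<phi> - H0_apply (F n) \<phi>) < e" if "m \<ge> M" "n \<ge> M" for m n
    proof -
      have "norm \<phi> * norm (F m - F n) \<le> norm \<phi> * (e / (norm \<phi> + 1))"
        using M[OF that] by (intro mult_left_mono) auto
      also have "\<dots> < e"
        using e by (simp add: pos_divide_less_eq add_nonneg_pos distrib_left mult.commute)
      finally show ?thesis using pw[of m \<phi> n] by simp
    qed
    then show "\<exists>M. \<forall>m\<ge>M. \<forall>n\<ge>M. norm (H0_apply (F m) \<phi> - H0_apply (F n) \<phi>) < e" by blast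
  qed
  then have "\<exists>l. (\<lambda>n. H0_apply (F n) \<phi>) \<longlonglongrightarrow> l" for \<phi>
    using Cauchy_convergent convergent_def by blast
  then obtain g where g: "\<And>\<phi>. (\<lambda>n. H0_apply (F n) \<phi>) \<longlonglongrightarrow> g \<phi>" by metis
  have hom: "pos_homogeneous g"
    unfolding pos_homogeneous_def
  proof (intro allI impI)
    fix c :: real and \<phi> assume "0 < c"
    then have "(\<lambda>n. H0_apply (F n) (c *\<^sub>R \<phi>)) \<longlonglongrightarrow> c * g \<phi>"
      using tendsto_mult_left[OF g[of \<phi>], of c] by (simp add: H0_apply_scale)
    then show "g (c *\<^sub>R \<phi>) = c * g \<phi>" using g LIMSEQ_unique by blast
  qed
  have lim: "(\<Sum>\<phi>\<leftarrow>\<phi>s. \<bar>H0_apply (F n) \<phi> - g \<phi>\<bar>) \<le> e"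
    if M: "\<And>m. m \<ge> M \<Longrightarrow> norm (F n - F m) \<le> e" and a: "\<phi>s \<in> admissible" for M n e \<phi>s
  proof (rule LIMSEQ_le_const2)
    have tl: "(\<lambda>m. \<Sum>\<phi>\<leftarrow>xs. \<bar>H0_apply (F n) \<phi> - H0_apply (F m) \<phi>\<bar>)
        \<longlonglongrightarrow> (\<Sum>\<phi>\<leftarrow>xs. \<bar>H0_apply (F n) \<phi> - g \<phi>\<bar>)" for xs
      by (induction xs) (auto intro!: tendsto_intros g)
    show "(\<lambda>m. \<Sum>\<phi>\<leftarrow>\<phi>s. \<bar>H0_apply (F n) \<phi> - H0_apply (F m) \<phi>\<bar>)
        \<longlonglongrightarrow> (\<Sum>\<phi>\<leftarrow>\<phi>s. \<bar>H0_apply (F n) \<phi> - g \<phi>\<bar>)" by (rule tl)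
    show "\<exists>N. \<forall>m\<ge>N. (\<Sum>\<phi>\<leftarrow>\<phi>s. \<bar>H0_apply (F n) \<phi> - H0_apply (F m) \<phi>\<bar>) \<le> e"
    proof (intro exI allI impI)
      fix m assume "M \<le> m"
      then show "(\<Sum>\<phi>\<leftarrow>\<phi>s. \<bar>H0_apply (F n) \<phi> - H0_apply (F m) \<phi>\<bar>) \<le> e"
        using H0_sum_le_norm[OF a, of "F n - F m"] M[of m] by (simp add: minus_H0.rep_eq)
    qed
  qed
  have fin: "FBL_norm g < top"
  proof -
    obtain M where M: "\<And>m n. m \<ge> M \<Longrightarrow> n \<ge> M \<Longrightarrow> norm (F m - F n) < 1"
      using F[of 1] by auto
    have "\<forall>\<phi>s\<in>admissible. (\<Sum>\<phi>\<leftarrow>\<phi>s. \<bar>H0_apply (F M) \<phi> - g \<phi>\<bar>) \<le> 1"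
      using lim[of M M 1] M less_imp_le by blast
    then have d: "FBL_norm (\<lambda>\<phi>. H0_apply (F M) \<phi> - g \<phi>) < top"
      unfolding FBL_norm_finite_iff by blast
    have "FBL_norm (H0_apply (F M)) < top" using H0_apply[of "F M"] by simp
    from this d show ?thesis by (rule H0_bound_mono) linarith
  qed
  define G where "G = Abs_H0 g"
  have G: "H0_apply G = g" using hom fin by (simp add: G_def Abs_H0_inverse)
  have "F \<longlonglongrightarrow> G"
    unfolding lim_sequentially
  proof (intro allI impI)
    fix e :: real assume e: "0 < e"
    then obtain M where M: "\<And>m n. m \<ge> M \<Longrightarrow> n \<ge> M \<Longrightarrow> norm (F m - F n) < e / 2"
      using F[of "e / 2"] by auto
    have "dist (F n) G < e" if "n \<ge> M" for n
    proof -
      have "norm (F n - G) \<le> e / 2"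
        using e lim[of M n "e / 2"] M[OF that] less_imp_le
        by (subst H0_norm_le_iff) (auto simp: minus_H0.rep_eq G)
      then show ?thesis using e by (simp add: dist_H0_def)
    qed
    then show "\<exists>M. \<forall>n\<ge>M. dist (F n) G < e" by blast
  qed
  then show "convergent F" by (auto simp: convergent_def)
qed

instance H0 :: (banach) banach_lattice
proof
  fix f g h :: "'a H0" and c d :: real
  show "f \<le> g \<Longrightarrow> h + f \<le> h + g" by transfer simp
  show "f \<le> g \<Longrightarrow> 0 \<le> c \<Longrightarrow> c *\<^sub>R f \<le> c *\<^sub>R g" by transfer (simp add: mult_left_mono)
  show "c \<le> d \<Longrightarrow> 0 \<le> f \<Longrightarrow> c *\<^sub>R f \<le> d *\<^sub>R f" by transfer (simp add: mult_right_mono)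
  show "\<bar>f\<bar> = sup f (- f)" by transfer (auto simp: fun_eq_iff)
  show "norm f \<le> norm g" if "\<bar>f\<bar> \<le> \<bar>g\<bar>"
  proof (subst H0_norm_le_iff, simp add: H0_norm_nonneg, intro ballI)
    fix \<phi>s :: "('a \<Rightarrow>\<^sub>L real) list" assume a: "\<phi>s \<in> admissible"
    from that have "\<bar>H0_apply f \<phi>\<bar> \<le> \<bar>H0_apply g \<phi>\<bar>" for \<phi>
      by (simp add: less_eq_H0.rep_eq abs_H0.rep_eq)
    then have "(\<Sum>\<phi>\<leftarrow>\<phi>s. \<bar>H0_apply f \<phi>\<bar>) \<le> (\<Sum>\<phi>\<leftarrow>\<phi>s. \<bar>H0_apply g \<phi>\<bar>)" by (intro sum_list_mono)
    also have "\<dots> \<le> norm g" using a by (rule H0_sum_le_norm)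
    finally show "(\<Sum>\<phi>\<leftarrow>\<phi>s. \<bar>H0_apply f \<phi>\<bar>) \<le> norm g" .
  qed
qed

section \<open>The free Banach lattice \<open>FBL[E]\<close>\<close>

lift_definition delta_H0 :: "'a::banach \<Rightarrow> 'a H0" is "\<lambda>x \<phi>. blinfun_apply \<phi> x"
proof -
  fix x :: 'a
  have "(\<Sum>\<phi>\<leftarrow>\<phi>s. \<bar>blinfun_apply \<phi> x\<bar>) \<le> norm x" if "\<phi>s \<in> admissible" for \<phi>s :: "('a \<Rightarrow>\<^sub>L real) list"
  proof (cases "x = 0")
    case True
    then show ?thesis by (simp add: blinfun.zero_right)
  next
    case False
    have "(\<Sum>\<phi>\<leftarrow>\<phi>s. \<bar>blinfun_apply \<phi> (x /\<^sub>R norm x)\<bar>) \<le> 1"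
      using that False by (auto simp: admissible_def)
    also have "(\<Sum>\<phi>\<leftarrow>\<phi>s. \<bar>blinfun_apply \<phi> (x /\<^sub>R norm x)\<bar>) = inverse (norm x) * (\<Sum>\<phi>\<leftarrow>\<phi>s. \<bar>blinfun_apply \<phi> x\<bar>)"
      by (simp add: blinfun.scaleR_right abs_mult sum_list_const_mult)
    finally show ?thesis using False by (simp add: field_simps)
  qed
  then show "pos_homogeneous (\<lambda>\<phi>. blinfun_apply \<phi> x) \<and> FBL_norm (\<lambda>\<phi>. blinfun_apply \<phi> x) < top"
    unfolding FBL_norm_finite_iff by (auto simp: pos_homogeneous_def blinfun.scaleR_left)
qed

lemma sublattice_Inter: "(\<And>Y. Y \<in> \<Y> \<Longrightarrow> sublattice Y) \<Longrightarrow> sublattice (\<Inter>\<Y>)"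
  unfolding sublattice_def subspace_def by (auto intro!: closed_Inter)

lemma sublattice_hull: "sublattice (sublattice hull A)"
  by (rule hull_in) (auto intro: sublattice_Inter)

text \<open>\<^term>\<open>sublattice hull A\<close> is the smallest closed sublattice containing \<open>A\<close>.\<close>

typedef (overloaded) 'a FBL = "sublattice hull (range (delta_H0 :: 'a::banach \<Rightarrow> 'a H0))"
  morphisms Rep_FBL Abs_FBL
  using hull_subset[of "range delta_H0" sublattice] by blast

setup_lifting type_definition_FBL

lemmas FBL_closure_rules =
  sublattice_hull[THEN sublattice_def[THEN iffD1], of "range delta_H0"]

instantiation FBL :: (banach) "{real_vector, lattice, abs}"
begin

lift_definition zero_FBL :: "'a FBL" is 0
  using FBL_closure_rules by (blast intro: subspace_0)

lift_definition plus_FBL :: "'a FBL \<Rightarrow> 'a FBL \<Rightarrow> 'a FBL" is "(+)"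
  using FBL_closure_rules by (blast intro: subspace_add)

lift_definition minus_FBL :: "'a FBL \<Rightarrow> 'a FBL \<Rightarrow> 'a FBL" is "(-)"
  using FBL_closure_rules by (blast intro: subspace_diff)

lift_definition uminus_FBL :: "'a FBL \<Rightarrow> 'a FBL" is uminus
  using FBL_closure_rules by (blast intro: subspace_neg)

lift_definition scaleR_FBL :: "real \<Rightarrow> 'a FBL \<Rightarrow> 'a FBL" is "(*\<^sub>R)"
  using FBL_closure_rules by (blast intro: subspace_scale)

lift_definition less_eq_FBL :: "'a FBL \<Rightarrow> 'a FBL \<Rightarrow> bool" is "(\<le>)" .

lift_definition less_FBL :: "'a FBL \<Rightarrow> 'a FBL \<Rightarrow> bool" is "(<)" .

lift_definition sup_FBL :: "'a FBL \<Rightarrow> 'a FBL \<Rightarrow> 'a FBL" is sup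
  using FBL_closure_rules by blast

lift_definition inf_FBL :: "'a FBL \<Rightarrow> 'a FBL \<Rightarrow> 'a FBL" is inf
  using FBL_closure_rules by blast

definition abs_FBL :: "'a FBL \<Rightarrow> 'a FBL" where
  "abs_FBL f = sup f (- f)"

instance
proof
  fix f g h :: "'a FBL" and c d :: real
  show "f + g + h = f + (g + h)" by transfer (rule add.assoc)
  show "f + g = g + f" by transfer (rule add.commute)
  show "0 + f = f" by transfer simp
  show "- f + f = 0" by transfer simp
  show "f - g = f + - g" by transfer simp
  show "c *\<^sub>R (f + g) = c *\<^sub>R f + c *\<^sub>R g" by transfer (rule scaleR_add_right)
  show "(c + d) *\<^sub>R f = c *\<^sub>R f + d *\<^sub>R f" by transfer (rule scaleR_add_left)
  show "c *\<^sub>R d *\<^sub>R f = (c * d) *\<^sub>R f" by transfer simp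
  show "1 *\<^sub>R f = f" by transfer simp
  show "f < g \<longleftrightarrow> f \<le> g \<and> \<not> g \<le> f" by transfer auto
  show "f \<le> f" by transfer simp
  show "f \<le> g \<Longrightarrow> g \<le> h \<Longrightarrow> f \<le> h" by transfer simp
  show "f \<le> g \<Longrightarrow> g \<le> f \<Longrightarrow> f = g" by transfer simp
  show "inf f g \<le> f" "inf f g \<le> g" by (transfer; simp)+
  show "h \<le> f \<Longrightarrow> h \<le> g \<Longrightarrow> h \<le> inf f g" by transfer simp
  show "f \<le> sup f g" "g \<le> sup f g" by (transfer; simp)+
  show "g \<le> f \<Longrightarrow> h \<le> f \<Longrightarrow> sup g h \<le> f" by transfer simp
qed

end

instantiation FBL :: (banach) real_normed_vector
begin

lift_definition norm_FBL :: "'a FBL \<Rightarrow> real" is norm .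

definition dist_FBL :: "'a FBL \<Rightarrow> 'a FBL \<Rightarrow> real" where
  "dist_FBL f g = norm (f - g)"

definition sgn_FBL :: "'a FBL \<Rightarrow> 'a FBL" where
  "sgn_FBL f = f /\<^sub>R norm f"

definition uniformity_FBL :: "('a FBL \<times> 'a FBL) filter" where
  "uniformity_FBL = (INF e\<in>{0<..}. principal {(x, y). dist x y < e})"

definition open_FBL :: "'a FBL set \<Rightarrow> bool" where
  "open_FBL U \<longleftrightarrow> (\<forall>x\<in>U. \<forall>\<^sub>F (x', y) in uniformity. x' = x \<longrightarrow> y \<in> U)"

instance
proof
  fix f g h :: "'a FBL" and c d :: real
  show "dist f g = norm (f - g)" by (rule dist_FBL_def)
  show "sgn f = f /\<^sub>R norm f" by (rule sgn_FBL_def)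
  show "uniformity = (INF e\<in>{0<..}. principal {(x, y). dist (x::'a FBL) y < e})"
    by (rule uniformity_FBL_def)
  show "open U \<longleftrightarrow> (\<forall>x\<in>U. \<forall>\<^sub>F (x', y) in uniformity. x' = x \<longrightarrow> y \<in> U)" for U :: "'a FBL set"
    by (rule open_FBL_def)
  show "norm f = 0 \<longleftrightarrow> f = 0" by transfer simp
  show "norm (f + g) \<le> norm f + norm g" by transfer (rule norm_triangle_ineq)
  show "norm (c *\<^sub>R f) = \<bar>c\<bar> * norm f" by transfer simp
qed

end

instance FBL :: (banach) banach
proof
  fix F :: "nat \<Rightarrow> 'a FBL"
  have d: "dist (Rep_FBL f) (Rep_FBL g) = dist f g" for f g :: "'a FBL"
    by (simp add: dist_FBL_def norm_FBL.rep_eq minus_FBL.rep_eq dist_norm)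
  assume "Cauchy F"
  then have "Cauchy (\<lambda>n. Rep_FBL (F n))" by (simp add: Cauchy_def d)
  then have "convergent (\<lambda>n. Rep_FBL (F n))" by (rule Cauchy_convergent)
  then obtain l where l: "(\<lambda>n. Rep_FBL (F n)) \<longlonglongrightarrow> l"
    by (rule convergentD[THEN exE])
  have "l \<in> sublattice hull (range delta_H0)"
    using closed_sequentially[OF _ _ l] FBL_closure_rules Rep_FBL by blast
  then obtain g where "l = Rep_FBL g" by (metis Rep_FBL_cases)
  with l have "F \<longlonglongrightarrow> g" by (simp add: lim_sequentially d)
  then show "convergent F" by (auto simp: convergent_def)
qed

instance FBL :: (banach) banach_lattice
proof
  fix f g h :: "'a FBL" and c d :: real
  show "f \<le> g \<Longrightarrow> h + f \<le> h + g" by transfer simp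
  show "f \<le> g \<Longrightarrow> 0 \<le> c \<Longrightarrow> c *\<^sub>R f \<le> c *\<^sub>R g" by transfer (rule scaleR_left_mono)
  show "c \<le> d \<Longrightarrow> 0 \<le> f \<Longrightarrow> c *\<^sub>R f \<le> d *\<^sub>R f" by transfer (rule scaleR_right_mono)
  show "\<bar>f\<bar> = sup f (- f)" by (rule abs_FBL_def)
  show "\<bar>f\<bar> \<le> \<bar>g\<bar> \<Longrightarrow> norm f \<le> norm g"
    unfolding abs_FBL_def by transfer (simp add: norm_lattice_mono abs_lattice)
qed

lift_definition delta_FBL :: "'a::banach \<Rightarrow> 'a FBL" is delta_H0
  by (simp add: hull_inc)

text \<open>Existence and uniqueness of this homomorphism are the instance \<open>T = id\<close> of the universal
  property of \<open>FBL[X]\<close>.\<close>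

definition beta_FBL :: "'a::banach_lattice FBL \<Rightarrow> 'a" where
  "beta_FBL = (THE \<beta>. lattice_hom \<beta> \<and> \<beta> \<circ> delta_FBL = id)"

definition lattice_lifting_property :: "'a::banach_lattice itself \<Rightarrow> bool" where
  "lattice_lifting_property _ \<longleftrightarrow>
     (\<exists>T::'a \<Rightarrow> 'a FBL. lattice_hom T \<and> beta_FBL \<circ> T = id)"

end

theory Submission
  imports Defs
begin

text \<open>
  Everything rests on the universal property of \<open>FBL[E]\<close>. A bounded \<open>T : E \<rightarrow> X\<close> generates a
  vector sublattice \<open>G\<close> of \<open>H\<^sub>0[E] \<times> X\<close> containing all \<open>(\<delta> x, T x)\<close>, and the point is that
  \<open>\<parallel>u\<parallel> \<le> \<parallel>T\<parallel> \<parallel>f\<parallel>\<close> for \<open>(f, u) \<in> G\<close>. Choose a positive functional \<open>\<psi>\<close> of norm at most one with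
  \<open>\<psi> \<bar>u\<bar> = \<parallel>u\<parallel>\<close>. Only finitely many positive parts enter the construction of \<open>(f, u)\<close>, and by
  Hahn-Banach \<open>\<psi>\<close> is a finite sum of positive functionals \<open>\<psi>\<^sub>i\<close> each of which commutes with all of
  them; hence \<open>\<psi>\<^sub>i u = f (\<psi>\<^sub>i \<circ> T)\<close>, and the family \<open>\<psi>\<^sub>i \<circ> T\<close>, rescaled by \<open>\<parallel>T\<parallel>\<close>, is admissible in
  the definition of \<open>\<parallel>f\<parallel>\<close>. The closure of \<open>G\<close> is then the graph of the extension of \<open>T\<close>.

  If \<open>T\<close> lifts \<open>\<beta>\<close>, then \<open>T \<circ> \<beta>\<close> is a projection onto \<open>range T\<close>. Conversely, lattice homomorphisms
  \<open>S : X \<rightarrow> FBL[E]\<close> and \<open>Q : FBL[E] \<rightarrow> X\<close> with \<open>Q \<circ> S = id\<close> yield the lifting \<open>U \<circ> S\<close>, where \<open>U\<close>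
  extends \<open>\<delta>\<^sub>X \<circ> Q \<circ> \<delta>\<^sub>E\<close>, because \<open>\<beta> \<circ> U\<close> and \<open>Q\<close> agree on \<open>\<delta>\<^sub>E\<close>.
\<close>

section \<open>The Hahn-Banach theorem\<close>

text \<open>Scaling is required only as an inequality, the form that passes directly to infima;
  applied to \<open>inverse c\<close> it yields equality.\<close>

definition sublinear :: "('a::real_vector \<Rightarrow> real) \<Rightarrow> bool" where
  "sublinear p \<longleftrightarrow> (\<forall>x y. p (x + y) \<le> p x + p y) \<and> (\<forall>c>0. \<forall>x. p (c *\<^sub>R x) \<le> c * p x)"

lemma sublinear_add: "sublinear p \<Longrightarrow> p (x + y) \<le> p x + p y"
  by (simp add: sublinear_def)

lemma sublinear_scale_le: "sublinear p \<Longrightarrow> 0 < c \<Longrightarrow> p (c *\<^sub>R x) \<le> c * p x"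
  by (simp add: sublinear_def)

lemma sublinear_scale:
  assumes "sublinear p" "0 < c"
  shows "p (c *\<^sub>R x) = c * p x"
proof -
  have "p (inverse c *\<^sub>R (c *\<^sub>R x)) \<le> inverse c * p (c *\<^sub>R x)"
    using assms by (intro sublinear_scale_le) auto
  then have "c * p x \<le> p (c *\<^sub>R x)" using assms by (simp add: field_simps)
  with sublinear_scale_le[OF assms, of x] show ?thesis by simp
qed

lemma sublinear_zero: "sublinear p \<Longrightarrow> p 0 = 0"
  using sublinear_scale[of p 2 0] by simp

lemma sublinear_minus: "sublinear p \<Longrightarrow> - p (- x) \<le> p x"
  using sublinear_add[of p x "- x"] sublinear_zero[of p] by simp

text \<open>Supplies the lower bounds for Zorn's lemma. The estimate
  \<open>- p (- x) \<le> q x\<close> keeps the infimum finite, and comparability gives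
  subadditivity: the smaller of \<open>q\<close> and \<open>r\<close> is split at
  \<open>x + y\<close>.\<close>

lemma sublinear_INF_chain:
  assumes "C \<noteq> {}" and sub: "\<And>q. q \<in> C \<Longrightarrow> sublinear q" and le: "\<And>q. q \<in> C \<Longrightarrow> q \<le> p"
    and chain: "\<And>q r. q \<in> C \<Longrightarrow> r \<in> C \<Longrightarrow> q \<le> r \<or> r \<le> q"
  shows "sublinear (\<lambda>x. INF q\<in>C. q x)" and "q \<in> C \<Longrightarrow> (INF q\<in>C. q x) \<le> q x"
proof -
  let ?u = "\<lambda>x. INF q\<in>C. q x"
  have "- p (- x) \<le> q x" if "q \<in> C" for q x
    using sublinear_minus[OF sub[OF that], of x] le_funD[OF le[OF that], of "- x"] by linarith
  then have bdd: "bdd_below ((\<lambda>q. q x) ` C)" for x by (intro bdd_belowI2)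
  have lower: "?u x \<le> q x" if "q \<in> C" for q x
    by (rule cINF_lower[OF bdd that])
  show "q \<in> C \<Longrightarrow> (INF q\<in>C. q x) \<le> q x" by (rule lower)
  have greatest: "b \<le> ?u x" if "\<And>q. q \<in> C \<Longrightarrow> b \<le> q x" for b x
    using \<open>C \<noteq> {}\<close> that by (rule cINF_greatest)
  have add: "?u (x + y) \<le> q x + r y" if q: "q \<in> C" and r: "r \<in> C" for q r x y
    using chain[OF q r]
  proof
    assume "q \<le> r"
    then show ?thesis using lower[OF q, of "x + y"] sublinear_add[OF sub[OF q], of x y]
      le_funD[of q r y] by linarith
  next
    assume "r \<le> q"
    then show ?thesis using lower[OF r, of "x + y"] sublinear_add[OF sub[OF r], of x y]
      le_funD[of r q x] by linarith
  qed
  have "?u (x + y) - q x \<le> ?u y" if "q \<in> C" for q x y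
    using add[OF that, of _ x y] by (intro greatest) (simp add: algebra_simps)
  then have "?u (x + y) - ?u y \<le> ?u x" for x y
    by (intro greatest) (simp add: algebra_simps)
  moreover have "?u (c *\<^sub>R x) / c \<le> ?u x" if "0 < c" for c x
  proof (rule greatest)
    fix q assume "q \<in> C"
    with lower[of q "c *\<^sub>R x"] sublinear_scale_le[OF sub, of q c x] that
    show "?u (c *\<^sub>R x) / c \<le> q x" by (simp add: field_simps)
  qed
  ultimately show "sublinear ?u"
    unfolding sublinear_def by (simp add: algebra_simps pos_divide_le_eq)
qed

text \<open>At \<open>t = 1\<close> the tilted functional satisfies \<open>r (- a) \<le> - q a\<close>, so a minimal sublinear functional,
  which equals each of its tilts, is odd and hence linear.\<close>

lemma sublinear_tilt:
  fixes q :: "'a::real_vector \<Rightarrow> real" and a :: 'a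
  assumes "sublinear q" and r_def: "\<And>x. r x = (INF t\<in>{0..}. q (x + t *\<^sub>R a) - t * q a)"
  shows "sublinear r" and "0 \<le> t \<Longrightarrow> r x \<le> q (x + t *\<^sub>R a) - t * q a"
proof -
  have scale: "q (t *\<^sub>R a) = t * q a" if "0 \<le> t" for t
    using that sublinear_scale[OF assms(1), of t a] sublinear_zero[OF assms(1)]
    by (cases "t = 0") auto
  have "- q (- x) \<le> q (x + t *\<^sub>R a) - t * q a" if "t \<in> {0..}" for x t
    using sublinear_add[OF assms(1), of "x + t *\<^sub>R a" "- x"] scale[of t] that by simp
  then have bdd: "bdd_below ((\<lambda>t. q (x + t *\<^sub>R a) - t * q a) ` {0..})" for x
    by (intro bdd_belowI2)
  have lower: "r x \<le> q (x + t *\<^sub>R a) - t * q a" if "0 \<le> t" for x t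
    unfolding r_def by (rule cINF_lower[OF bdd]) (use that in simp)
  then show "0 \<le> t \<Longrightarrow> r x \<le> q (x + t *\<^sub>R a) - t * q a" .
  have greatest: "b \<le> r x" if "\<And>t. 0 \<le> t \<Longrightarrow> b \<le> q (x + t *\<^sub>R a) - t * q a" for b x
    unfolding r_def by (rule cINF_greatest) (use that in auto)
  \<comment> \<open>Parameters \<open>s\<close> for \<open>x\<close> and \<open>t\<close> for
    \<open>y\<close> combine to the parameter \<open>s + t\<close> for \<open>x + y\<close>.\<close>
  have "r (x + y) - (q (x + s *\<^sub>R a) - s * q a) \<le> r y" if s: "0 \<le> s" for x y s
  proof (rule greatest)
    fix t :: real assume t: "0 \<le> t"
    have "r (x + y) \<le> q ((x + y) + (s + t) *\<^sub>R a) - (s + t) * q a"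
      using s t by (intro lower) simp
    also have "(x + y) + (s + t) *\<^sub>R a = (x + s *\<^sub>R a) + (y + t *\<^sub>R a)"
      by (simp add: algebra_simps)
    finally show "r (x + y) - (q (x + s *\<^sub>R a) - s * q a) \<le> q (y + t *\<^sub>R a) - t * q a"
      using sublinear_add[OF assms(1), of "x + s *\<^sub>R a" "y + t *\<^sub>R a"]
      by (simp add: algebra_simps)
  qed
  then have "r (x + y) - r y \<le> r x" for x y
    by (intro greatest) (simp add: algebra_simps)
  moreover have "r (c *\<^sub>R x) / c \<le> r x" if c: "0 < c" for c x
  proof (rule greatest)
    fix t :: real assume "0 \<le> t"
    with c have "r (c *\<^sub>R x) \<le> q (c *\<^sub>R x + (c * t) *\<^sub>R a) - c * t * q a"
      by (intro lower) simp
    also have "c *\<^sub>R x + (c * t) *\<^sub>R a = c *\<^sub>R (x + t *\<^sub>R a)" by (simp add: scaleR_add_right)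
    finally show "r (c *\<^sub>R x) / c \<le> q (x + t *\<^sub>R a) - t * q a"
      using c sublinear_scale[OF assms(1) c, of "x + t *\<^sub>R a"] by (simp add: field_simps)
  qed
  ultimately show "sublinear r"
    unfolding sublinear_def by (simp add: algebra_simps pos_divide_le_eq)
qed

lemma sublinear_odd_linear:
  assumes "sublinear q" and odd: "\<And>x. q (- x) = - q x"
  shows "linear q"
proof (rule linearI)
  show "q (x + y) = q x + q y" for x y
    using sublinear_add[OF assms(1), of x y] sublinear_add[OF assms(1), of "- x" "- y"]
      odd[of "x + y"] odd[of x] odd[of y] by simp
  show "q (c *\<^sub>R x) = c *\<^sub>R q x" for c x
  proof (cases c "0 :: real" rule: linorder_cases)
    case less
    then show ?thesis using sublinear_scale[OF assms(1), of "- c" x] odd[of "c *\<^sub>R x"] by simp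
  qed (auto simp: sublinear_zero[OF assms(1)] sublinear_scale[OF assms(1)])
qed

text \<open>Zorn's lemma for the reversed pointwise order gives a minimal sublinear functional below
  \<open>p\<close>; equality with its tilts makes it linear.\<close>

lemma sublinear_dominates_linear:
  assumes p: "sublinear p"
  shows "\<exists>f. linear f \<and> f \<le> p"
proof -
  define A where "A = {q. sublinear q \<and> q \<le> p}"
  have "\<exists>m\<in>A. \<forall>q\<in>A. m \<ge> q \<longrightarrow> q = m"
  proof (rule predicate_Zorn)
    show "partial_order_on A (relation_of (\<lambda>q r. q \<ge> r) A)"
      by (rule partial_order_on_relation_ofI) auto
    fix C assume C: "C \<in> Chains (relation_of (\<lambda>q r. q \<ge> r) A)"
    then have CA: "q \<in> A" if "q \<in> C" for q
      using that by (auto simp: Chains_def relation_of_def)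
    show "\<exists>u\<in>A. \<forall>a\<in>C. a \<ge> u"
    proof (cases "C = {}")
      case True
      then show ?thesis using p by (auto simp: A_def)
    next
      case False
      have *: "\<And>q. q \<in> C \<Longrightarrow> sublinear q" "\<And>q. q \<in> C \<Longrightarrow> q \<le> p"
        "\<And>q r. q \<in> C \<Longrightarrow> r \<in> C \<Longrightarrow> q \<le> r \<or> r \<le> q"
        using C CA by (auto simp: A_def Chains_def relation_of_def)
      have u: "sublinear (\<lambda>x. INF q\<in>C. q x)"
        by (rule sublinear_INF_chain(1)[OF False *])
      have u_le: "(INF q\<in>C. q x) \<le> q x" if "q \<in> C" for q x
        by (rule sublinear_INF_chain(2)[OF False *]) (use that in auto)
      obtain q where q: "q \<in> C" using False by blast
      have "(\<lambda>x. INF q\<in>C. q x) \<le> q'" if "q' \<in> C" for q'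
        using u_le[OF that] by (simp add: le_fun_def)
      with u *(2)[OF q] q show ?thesis
        unfolding A_def by (intro bexI[of _ "\<lambda>x. INF q\<in>C. q x"]) (auto intro: order.trans)
    qed
  qed
  then obtain m where m: "sublinear m" "m \<le> p"
    and minimal: "\<And>q. sublinear q \<Longrightarrow> q \<le> p \<Longrightarrow> q \<le> m \<Longrightarrow> q = m"
    unfolding A_def by blast
  have "m (- a) = - m a" for a
  proof -
    define r where "r x = (INF t\<in>{0..}. m (x + t *\<^sub>R a) - t * m a)" for x
    note tilt = sublinear_tilt[OF m(1) r_def]
    have "r \<le> m" using tilt(2)[of 0] by (simp add: le_fun_def)
    then have "r = m" using tilt(1) m(2) by (intro minimal) auto
    then have "m (- a) \<le> - m a"
      using tilt(2)[of 1 "- a"] sublinear_zero[OF m(1)] by simp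
    with sublinear_minus[OF m(1), of a] show ?thesis by simp
  qed
  then have "linear m" by (rule sublinear_odd_linear[OF m(1)])
  with m(2) show ?thesis by blast
qed

text \<open>Any linear \<open>f\<close> below the tilt of \<open>p\<close> at \<open>a\<close>
  satisfies \<open>f (- a) \<le> - p a\<close>, which turns domination by \<open>p\<close> into
  equality at \<open>a\<close>.\<close>

theorem Hahn_Banach_support:
  fixes p :: "'a::real_vector \<Rightarrow> real" and a :: 'a
  assumes "sublinear p"
  obtains f where "linear f" "\<And>x. f x \<le> p x" "f a = p a"
proof -
  define r where "r x = (INF t\<in>{0..}. p (x + t *\<^sub>R a) - t * p a)" for x
  note tilt = sublinear_tilt[OF assms r_def]
  obtain f where f: "linear f" "f \<le> r"
    using sublinear_dominates_linear[OF tilt(1)] by blast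
  have le: "f x \<le> p x" for x
    using le_funD[OF f(2), of x] tilt(2)[of 0 x] by simp
  have "f (- a) \<le> - p a"
    using le_funD[OF f(2), of "- a"] tilt(2)[of 1 "- a"] sublinear_zero[OF assms] by simp
  then have "f a = p a" using le[of a] linear_neg[OF f(1), of a] by simp
  with f(1) le show ?thesis by (rule that)
qed

section \<open>Positive functionals on Banach lattices\<close>

definition positive_functional :: "('a::banach_lattice \<Rightarrow> real) \<Rightarrow> bool" where
  "positive_functional \<psi> \<longleftrightarrow> linear \<psi> \<and> (\<forall>z\<ge>0. 0 \<le> \<psi> z)"

section \<open>Positive parts in Banach lattices\<close>

lemma pprt_minus_pprt_uminus: "pprt w - pprt (- w) = (w :: 'a::lattice_ab_group_add)"
  using prts[of w] by (simp add: pprt_neg)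

lemma abs_eq_pprt_add: "\<bar>w\<bar> = pprt w + pprt (- w :: 'a::lattice_ab_group_add_abs)"
  using abs_prts[of w] by (simp add: pprt_neg)

text \<open>Together with \<open>inf_eq_pprt\<close> this reduces questions on sublattices and
  lattice homomorphisms to linearity and the single operation \<open>pprt\<close>.\<close>

lemma sup_eq_pprt: "sup a b = b + pprt (a - b :: 'a::lattice_ab_group_add)"
  by (simp add: pprt_def add_sup_distrib_left)

lemma inf_eq_pprt: "inf a b = a - pprt (a - b :: 'a::lattice_ab_group_add)"
  using sup_eq_pprt[of "- b" "- a"] by (simp add: inf_eq_neg_sup sup_commute)

lemma pprt_add_le: "pprt (a + b) \<le> pprt a + pprt (b :: 'a::lattice_ab_group_add)"
  unfolding pprt_def[of "a + b"] by (rule sup_least) (auto intro: add_mono simp: pprt_def)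

lemma pprt_scale_le:
  assumes "0 \<le> c" shows "pprt (c *\<^sub>R a) \<le> c *\<^sub>R pprt (a :: 'a::banach_lattice)"
  unfolding pprt_def[of "c *\<^sub>R a"] using assms
  by (intro sup_least scaleR_left_mono scaleR_nonneg_nonneg) (auto simp: pprt_def)

lemma norm_mono_nonneg: "0 \<le> a \<Longrightarrow> a \<le> b \<Longrightarrow> norm a \<le> norm (b :: 'a::banach_lattice)"
  by (rule norm_lattice_mono) (use order.trans[of 0 a b] in simp)

lemma norm_abs_lattice: "norm \<bar>a\<bar> = norm (a :: 'a::banach_lattice)"
  by (intro order.antisym norm_lattice_mono) simp_all

text \<open>Subadditivity of \<open>pprt\<close> bounds the difference and its negative by
  \<open>\<bar>a - b\<bar>\<close>, and the norm is monotone in the modulus.\<close>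

lemma norm_pprt_diff_le: "norm (pprt a - pprt b) \<le> norm (a - b :: 'a::banach_lattice)"
proof (rule norm_lattice_mono)
  have *: "pprt a - pprt b \<le> \<bar>a - b\<bar>" for a b :: 'a
  proof -
    have "pprt a \<le> pprt (a - b) + pprt b" using pprt_add_le[of "a - b" b] by simp
    also have "pprt (a - b) \<le> \<bar>a - b\<bar>" unfolding abs_eq_pprt_add by simp
    finally show ?thesis by (simp add: diff_le_eq)
  qed
  show "\<bar>pprt a - pprt b\<bar> \<le> \<bar>a - b\<bar>"
    using *[of a b] *[of b a] by (intro abs_leI) (simp_all only: minus_diff_eq abs_minus_commute[of b a])
qed

lemma continuous_pprt: "continuous_on A (pprt :: 'a::banach_lattice \<Rightarrow> 'a)"
  unfolding continuous_on_iff dist_norm using norm_pprt_diff_le le_less_trans by blast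

section \<open>Decomposition of positive functionals\<close>

text \<open>For positive \<open>\<psi>\<close> this says exactly that \<open>\<psi> (pprt w) = max (\<psi> w) 0\<close>, but in a form that positive
  functionals below \<open>\<psi>\<close> visibly inherit.\<close>

definition sign_definite :: "('a::banach_lattice \<Rightarrow> real) \<Rightarrow> 'a \<Rightarrow> bool" where
  "sign_definite \<psi> w \<longleftrightarrow> \<psi> (pprt w) = 0 \<or> \<psi> (pprt (- w)) = 0"

lemma positive_functional_mono: "positive_functional \<psi> \<Longrightarrow> x \<le> y \<Longrightarrow> \<psi> x \<le> \<psi> y"
  using linear_diff[of \<psi> y x] by (simp add: positive_functional_def) (metis diff_ge_0_iff_ge)

lemma sign_definite_pprt:
  assumes "positive_functional \<psi>" "sign_definite \<psi> w"
  shows "\<psi> (pprt w) = max (\<psi> w) 0"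
proof -
  have "\<psi> w = \<psi> (pprt w) - \<psi> (pprt (- w))"
    using assms(1) linear_diff[of \<psi> "pprt w" "pprt (- w)"]
    by (simp add: pprt_minus_pprt_uminus positive_functional_def)
  moreover have "0 \<le> \<psi> (pprt w)" "0 \<le> \<psi> (pprt (- w))"
    using assms(1) by (simp_all add: positive_functional_def)
  ultimately show ?thesis using assms(2) by (auto simp: sign_definite_def)
qed

lemma sign_definite_abs:
  assumes "positive_functional \<psi>" "sign_definite \<psi> w"
  shows "\<psi> \<bar>w\<bar> = \<bar>\<psi> w\<bar>"
proof -
  have "\<psi> w = \<psi> (pprt w) - \<psi> (pprt (- w))"
    using assms(1) linear_diff[of \<psi> "pprt w" "pprt (- w)"]
    by (simp add: pprt_minus_pprt_uminus positive_functional_def)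
  moreover have "\<psi> \<bar>w\<bar> = \<psi> (pprt w) + \<psi> (pprt (- w))"
    using assms(1) linear_add[of \<psi> "pprt w" "pprt (- w)"]
    by (simp add: abs_eq_pprt_add positive_functional_def)
  moreover have "0 \<le> \<psi> (pprt w)" "0 \<le> \<psi> (pprt (- w))"
    using assms(1) by (simp_all add: positive_functional_def)
  ultimately show ?thesis using assms(2) by (auto simp: sign_definite_def)
qed

text \<open>The functional supporting \<open>\<psi> (pprt z)\<close> at \<open>w\<close> acts like
  the restriction of \<open>\<psi>\<close> to the set where \<open>w\<close> is positive: it agrees
  with \<open>\<psi>\<close> on \<open>pprt w\<close> and vanishes on \<open>pprt (- w)\<close>. The
  remainder vanishes on \<open>pprt w\<close>.\<close>

lemma positive_functional_split:
  fixes w :: "'a::banach_lattice"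
  assumes \<psi>: "positive_functional \<psi>"
  obtains \<psi>1 \<psi>2 where "positive_functional \<psi>1" "positive_functional \<psi>2"
    "\<And>z. \<psi> z = \<psi>1 z + \<psi>2 z" "sign_definite \<psi>1 w" "sign_definite \<psi>2 w"
proof -
  have lin: "linear \<psi>" using \<psi> by (simp add: positive_functional_def)
  have "sublinear (\<lambda>z. \<psi> (pprt z))"
    unfolding sublinear_def
    using positive_functional_mono[OF \<psi> pprt_add_le] positive_functional_mono[OF \<psi> pprt_scale_le]
    by (simp add: linear_add[OF lin] linear_scale[OF lin])
  then obtain f where f: "linear f" "\<And>x. f x \<le> \<psi> (pprt x)" "f w = \<psi> (pprt w)"
    by (rule Hahn_Banach_support[of _ w]) blast
  have pos: "0 \<le> f z" "f z \<le> \<psi> z" if "0 \<le> z" for z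
    using f(2)[of "- z"] f(2)[of z] that linear_neg[OF f(1), of z] linear_0[OF lin] by simp_all
  have f1: "positive_functional f" using f(1) pos by (simp add: positive_functional_def)
  have f2: "positive_functional (\<lambda>z. \<psi> z - f z)"
    using linear_compose_sub[OF lin f(1)] pos by (simp add: positive_functional_def)
  \<comment> \<open>Sandwich:
    \<open>\<psi> (pprt w) = f w \<le> f (pprt w) \<le> \<psi> (pprt w)\<close>.\<close>
  have "f w \<le> f (pprt w)" by (rule positive_functional_mono[OF f1]) (simp add: pprt_def)
  then have eq: "f (pprt w) = \<psi> (pprt w)" using f(3) pos(2)[of "pprt w"] by simp
  have "f w = f (pprt w) - f (pprt (- w))"
    using linear_diff[OF f(1), of "pprt w" "pprt (- w)"] by (simp add: pprt_minus_pprt_uminus)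
  with eq f(3) have "sign_definite f w" by (simp add: sign_definite_def)
  moreover have "sign_definite (\<lambda>z. \<psi> z - f z) w" using eq by (simp add: sign_definite_def)
  ultimately show ?thesis using f1 f2 by (intro that[of f "\<lambda>z. \<psi> z - f z"]) auto
qed

text \<open>Split along one element of \<open>W\<close> after another. Each summand stays below its
  predecessor on the positive cone, so a value 0 on a positive part persists and earlier sign
  definiteness survives later splits.\<close>

lemma positive_functional_decompose:
  fixes W :: "'a::banach_lattice list"
  assumes "positive_functional \<psi>"
  shows "\<exists>\<psi>s. (\<forall>z. \<psi> z = (\<Sum>\<eta>\<leftarrow>\<psi>s. \<eta> z)) \<and>
    (\<forall>\<eta>\<in>set \<psi>s. positive_functional \<eta> \<and> (\<forall>z\<ge>0. \<eta> z \<le> \<psi> z) \<and> (\<forall>w\<in>set W. sign_definite \<eta> w))"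
  using assms
proof (induction W arbitrary: \<psi>)
  case Nil
  then show ?case by (intro exI[of _ "[\<psi>]"]) simp
next
  case (Cons w W)
  obtain \<psi>1 \<psi>2 where \<psi>12: "positive_functional \<psi>1" "positive_functional \<psi>2"
    "\<And>z. \<psi> z = \<psi>1 z + \<psi>2 z" "sign_definite \<psi>1 w" "sign_definite \<psi>2 w"
    using positive_functional_split[OF Cons.prems] by blast
  obtain A where A: "\<And>z. \<psi>1 z = (\<Sum>\<eta>\<leftarrow>A. \<eta> z)" "\<And>\<eta>. \<eta> \<in> set A \<Longrightarrow> positive_functional \<eta>"
    "\<And>\<eta> z. \<eta> \<in> set A \<Longrightarrow> 0 \<le> z \<Longrightarrow> \<eta> z \<le> \<psi>1 z"
    "\<And>\<eta> v. \<eta> \<in> set A \<Longrightarrow> v \<in> set W \<Longrightarrow> sign_definite \<eta> v"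
    using Cons.IH[OF \<psi>12(1)] by blast
  obtain B where B: "\<And>z. \<psi>2 z = (\<Sum>\<eta>\<leftarrow>B. \<eta> z)" "\<And>\<eta>. \<eta> \<in> set B \<Longrightarrow> positive_functional \<eta>"
    "\<And>\<eta> z. \<eta> \<in> set B \<Longrightarrow> 0 \<le> z \<Longrightarrow> \<eta> z \<le> \<psi>2 z"
    "\<And>\<eta> v. \<eta> \<in> set B \<Longrightarrow> v \<in> set W \<Longrightarrow> sign_definite \<eta> v"
    using Cons.IH[OF \<psi>12(2)] by blast
  have mono: "sign_definite \<eta> w"
    if "positive_functional \<eta>" "\<And>z. 0 \<le> z \<Longrightarrow> \<eta> z \<le> \<phi> z" "sign_definite \<phi> w" for \<eta> \<phi>
  proof -
    have "0 \<le> \<eta> (pprt w)" "0 \<le> \<eta> (pprt (- w))"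
      using that(1) by (simp_all add: positive_functional_def)
    then show ?thesis
      using that(2)[of "pprt w"] that(2)[of "pprt (- w)"] that(3) by (auto simp: sign_definite_def)
  qed
  have pos: "0 \<le> \<psi>1 z" "0 \<le> \<psi>2 z" if "0 \<le> z" for z
    using \<psi>12(1,2) that by (simp_all add: positive_functional_def)
  show ?case
  proof (intro exI[of _ "A @ B"] conjI allI ballI impI)
    show "\<psi> z = (\<Sum>\<eta>\<leftarrow>A @ B. \<eta> z)" for z using A(1)[of z] B(1)[of z] \<psi>12(3)[of z] by simp
    fix \<eta> assume \<eta>: "\<eta> \<in> set (A @ B)"
    then show "positive_functional \<eta>" using A(2) B(2) by auto
    show "\<eta> z \<le> \<psi> z" if "0 \<le> z" for z
      using \<eta> A(3)[OF _ that, of \<eta>] B(3)[OF _ that, of \<eta>] pos[OF that] \<psi>12(3)[of z] by auto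
    show "sign_definite \<eta> v" if "v \<in> set (w # W)" for v
      using that \<eta> A(2-4) B(2-4) mono[OF _ _ \<psi>12(4), of \<eta>] mono[OF _ _ \<psi>12(5), of \<eta>] by auto
  qed
qed

text \<open>Support \<open>norm (pprt z)\<close> at \<open>\<bar>u\<bar>\<close>. This gauge
  vanishes on negative elements, which forces the supporting functional to be positive.\<close>

lemma norming_positive_functional:
  fixes u :: "'a::banach_lattice"
  obtains \<psi> where "positive_functional \<psi>" "\<And>z. \<psi> z \<le> norm z" "\<psi> \<bar>u\<bar> = norm u"
proof -
  have "sublinear (\<lambda>z::'a. norm (pprt z))"
    unfolding sublinear_def
  proof (intro conjI allI impI)
    fix x y :: 'a
    have "norm (pprt (x + y)) \<le> norm (pprt x + pprt y)"
      by (intro norm_mono_nonneg pprt_add_le) simp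
    then show "norm (pprt (x + y)) \<le> norm (pprt x) + norm (pprt y)"
      using norm_triangle_ineq order.trans by blast
  next
    fix c :: real and x :: 'a assume "0 < c"
    then have "norm (pprt (c *\<^sub>R x)) \<le> norm (c *\<^sub>R pprt x)"
      by (intro norm_mono_nonneg pprt_scale_le) simp_all
    then show "norm (pprt (c *\<^sub>R x)) \<le> c * norm (pprt x)" using \<open>0 < c\<close> by simp
  qed
  then obtain f where f: "linear f" "\<And>x. f x \<le> norm (pprt x)" "f \<bar>u\<bar> = norm (pprt \<bar>u\<bar>)"
    by (rule Hahn_Banach_support[of _ "\<bar>u\<bar>"]) blast
  have "0 \<le> f z" if "0 \<le> z" for z
    using f(2)[of "- z"] that linear_neg[OF f(1), of z] by simp
  then have "positive_functional f" using f(1) by (simp add: positive_functional_def)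
  moreover have "f z \<le> norm z" for z
    using f(2)[of z] norm_pprt_diff_le[of z 0] by simp
  moreover have "f \<bar>u\<bar> = norm u" using f(3) by (simp add: norm_abs_lattice)
  ultimately show ?thesis by (rule that)
qed

lemma positive_functional_abs_le: "positive_functional \<psi> \<Longrightarrow> \<bar>\<psi> z\<bar> \<le> \<psi> \<bar>z\<bar>"
  using positive_functional_mono[of \<psi> z "\<bar>z\<bar>"] positive_functional_mono[of \<psi> "- z" "\<bar>z\<bar>"]
    linear_neg[of \<psi> z] by (simp add: positive_functional_def abs_ge_self abs_ge_minus_self)

lemma positive_functional_bounded_linear:
  assumes "positive_functional \<psi>" "\<And>z. 0 \<le> z \<Longrightarrow> \<psi> z \<le> norm z"
  shows "bounded_linear \<psi>"
proof (rule bounded_linear_intro[of _ 1])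
  have lin: "linear \<psi>" using assms(1) by (simp add: positive_functional_def)
  show "\<psi> (x + y) = \<psi> x + \<psi> y" "\<psi> (c *\<^sub>R x) = c *\<^sub>R \<psi> x" for x y c
    by (simp_all add: linear_add[OF lin] linear_scale[OF lin])
  show "norm (\<psi> z) \<le> norm z * 1" for z
    using positive_functional_abs_le[OF assms(1), of z] assms(2)[of "\<bar>z\<bar>"]
    by (simp add: norm_abs_lattice)
qed

section \<open>The universal property of the free Banach lattice\<close>

text \<open>Generated inductively, so that every pair arises from finitely many positive parts. It
  is only a relation at first; the norm estimate below makes it single-valued.\<close>

inductive_set extension_graph :: "('a::banach \<Rightarrow> 'b::banach_lattice) \<Rightarrow> ('a H0 \<times> 'b) set"
  for T where
  delta: "(delta_H0 x, T x) \<in> extension_graph T"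
| add: "p \<in> extension_graph T \<Longrightarrow> q \<in> extension_graph T \<Longrightarrow> p + q \<in> extension_graph T"
| scale: "p \<in> extension_graph T \<Longrightarrow> c *\<^sub>R p \<in> extension_graph T"
| pprt: "(f, u) \<in> extension_graph T \<Longrightarrow> (pprt f, pprt u) \<in> extension_graph T"

text \<open>\<open>W\<close> records the elements whose positive parts have been taken; on these,
  \<open>\<psi>\<close> must commute with \<open>pprt\<close>. \<open>Blinfun\<close> is meaningful
  only for bounded maps, hence the boundedness condition.\<close>

definition pairing_compatible :: "('a::banach \<Rightarrow> 'b::banach_lattice) \<Rightarrow> 'b set \<Rightarrow> 'a H0 \<Rightarrow> 'b \<Rightarrow> bool" where
  "pairing_compatible T W f u \<longleftrightarrow> (\<forall>\<psi>. positive_functional \<psi> \<longrightarrow> bounded_linear \<psi> \<longrightarrow>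
    (\<forall>w\<in>W. sign_definite \<psi> w) \<longrightarrow> H0_apply f (Blinfun (\<psi> \<circ> T)) = \<psi> u)"

lemma pairing_compatibleD:
  "pairing_compatible T W f u \<Longrightarrow> positive_functional \<psi> \<Longrightarrow> bounded_linear \<psi> \<Longrightarrow>
    (\<And>w. w \<in> W \<Longrightarrow> sign_definite \<psi> w) \<Longrightarrow> H0_apply f (Blinfun (\<psi> \<circ> T)) = \<psi> u"
  unfolding pairing_compatible_def by blast

lemma pairing_compatible_delta:
  assumes "bounded_linear T" shows "pairing_compatible T W (delta_H0 x) (T x)"
  unfolding pairing_compatible_def
proof (intro allI impI)
  fix \<psi> :: "'b \<Rightarrow> real" assume "bounded_linear \<psi>"
  from bounded_linear_compose[OF this assms]
  show "H0_apply (delta_H0 x) (Blinfun (\<psi> \<circ> T)) = \<psi> (T x)"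
    by (simp add: delta_H0.rep_eq bounded_linear_Blinfun_apply comp_def)
qed

lemma pairing_compatible_add:
  assumes "pairing_compatible T W f u" "pairing_compatible T V g v"
  shows "pairing_compatible T (W \<union> V) (f + g) (u + v)"
  unfolding pairing_compatible_def
proof (intro allI impI)
  fix \<psi> :: "'b \<Rightarrow> real"
  assume \<psi>: "positive_functional \<psi>" "bounded_linear \<psi>" and sd: "\<forall>w\<in>W \<union> V. sign_definite \<psi> w"
  have "\<psi> (u + v) = \<psi> u + \<psi> v"
    using \<psi>(2) by (intro linear_add bounded_linear.linear)
  then show "H0_apply (f + g) (Blinfun (\<psi> \<circ> T)) = \<psi> (u + v)"
    using pairing_compatibleD[OF assms(1) \<psi>] pairing_compatibleD[OF assms(2) \<psi>] sd
    by (simp add: plus_H0.rep_eq)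
qed

lemma pairing_compatible_scale:
  assumes "pairing_compatible T W f u"
  shows "pairing_compatible T W (c *\<^sub>R f) (c *\<^sub>R u)"
  unfolding pairing_compatible_def
proof (intro allI impI)
  fix \<psi> :: "'b \<Rightarrow> real"
  assume \<psi>: "positive_functional \<psi>" "bounded_linear \<psi>" and sd: "\<forall>w\<in>W. sign_definite \<psi> w"
  have "\<psi> (c *\<^sub>R u) = c *\<^sub>R \<psi> u"
    using \<psi>(2) by (intro linear_scale bounded_linear.linear)
  then show "H0_apply (c *\<^sub>R f) (Blinfun (\<psi> \<circ> T)) = \<psi> (c *\<^sub>R u)"
    using pairing_compatibleD[OF assms \<psi>] sd by (simp add: scaleR_H0.rep_eq)
qed

text \<open>Positive parts in \<open>H0\<close> are pointwise, so the claim is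
  \<open>\<psi> (pprt u) = max (\<psi> u) 0\<close>; this is why \<open>u\<close> joins
  \<open>W\<close>.\<close>

lemma pairing_compatible_pprt:
  assumes "pairing_compatible T W f u"
  shows "pairing_compatible T (insert u W) (pprt f) (pprt u)"
  unfolding pairing_compatible_def
proof (intro allI impI)
  fix \<psi> :: "'b \<Rightarrow> real"
  assume \<psi>: "positive_functional \<psi>" "bounded_linear \<psi>" and sd: "\<forall>w\<in>insert u W. sign_definite \<psi> w"
  then show "H0_apply (pprt f) (Blinfun (\<psi> \<circ> T)) = \<psi> (pprt u)"
    using pairing_compatibleD[OF assms \<psi>]
    by (simp add: pprt_def[of f] sup_H0.rep_eq zero_H0.rep_eq sign_definite_pprt)
qed

lemma extension_graph_pairing_compatible:
  assumes "p \<in> extension_graph T" and T: "bounded_linear T"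
  shows "\<exists>W. finite W \<and> pairing_compatible T W (fst p) (snd p)"
  using assms(1)
proof induction
  case (delta x)
  show ?case using pairing_compatible_delta[OF T, of "{}" x] by auto
next
  case (add p q)
  then obtain W V where "finite W" "pairing_compatible T W (fst p) (snd p)"
    "finite V" "pairing_compatible T V (fst q) (snd q)" by blast
  then show ?case using pairing_compatible_add by (metis finite_UnI fst_add snd_add)
next
  case (scale p c)
  then show ?case using pairing_compatible_scale by (metis fst_scaleR snd_scaleR)
next
  case (pprt f u)
  then show ?case using pairing_compatible_pprt by (metis finite_insert fst_conv snd_conv)
qed

text \<open>The key estimate: it makes the extension well defined, bounded, and defined on a closed
  domain.\<close>

lemma extension_graph_norm_le:
  assumes "(f, u) \<in> extension_graph T" and T: "bounded_linear T"
    and K: "0 < K" "\<And>x. norm (T x) \<le> K * norm x"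
  shows "norm u \<le> K * norm f"
proof -
  obtain W where "finite W" and compat: "pairing_compatible T W f u"
    using extension_graph_pairing_compatible[OF assms(1,2)] by auto
  then obtain ws where ws: "W = set ws" using finite_list by blast
  obtain \<psi> where \<psi>: "positive_functional \<psi>" "\<And>z. \<psi> z \<le> norm z" "\<psi> \<bar>u\<bar> = norm u"
    using norming_positive_functional[of u] by blast
  \<comment> \<open>Including \<open>u\<close> itself in the list gives
    \<open>\<eta> \<bar>u\<bar> = \<bar>\<eta> u\<bar>\<close> for every summand.\<close>
  obtain \<psi>s where \<psi>s: "\<And>z. \<psi> z = (\<Sum>\<eta>\<leftarrow>\<psi>s. \<eta> z)"
    and pos: "\<And>\<eta>. \<eta> \<in> set \<psi>s \<Longrightarrow> positive_functional \<eta>"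
    and le: "\<And>\<eta> z. \<eta> \<in> set \<psi>s \<Longrightarrow> 0 \<le> z \<Longrightarrow> \<eta> z \<le> \<psi> z"
    and sd: "\<And>\<eta> w. \<eta> \<in> set \<psi>s \<Longrightarrow> w \<in> set (u # ws) \<Longrightarrow> sign_definite \<eta> w"
    using positive_functional_decompose[OF \<psi>(1), of "u # ws"] by blast
  have bl: "bounded_linear \<eta>" if "\<eta> \<in> set \<psi>s" for \<eta>
    using pos[OF that] le[OF that] \<psi>(2) by (intro positive_functional_bounded_linear) (auto intro: order.trans)
  define \<phi> where "\<phi> \<eta> = inverse K *\<^sub>R Blinfun (\<eta> \<circ> T)" for \<eta> :: "'b \<Rightarrow> real"
  have \<phi>_apply: "blinfun_apply (\<phi> \<eta>) x = \<eta> (T x) / K" if "\<eta> \<in> set \<psi>s" for \<eta> x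
    using bounded_linear_compose[OF bl[OF that] T]
    by (simp add: \<phi>_def scaleR_blinfun.rep_eq bounded_linear_Blinfun_apply comp_def divide_inverse)
  have "(\<Sum>\<eta>\<leftarrow>\<psi>s. \<bar>blinfun_apply (\<phi> \<eta>) x\<bar>) \<le> 1" if "norm x \<le> 1" for x
  proof -
    \<comment> \<open>Positivity moves the modulus inside, where the summands add up to
      \<open>\<psi>\<close>, a functional dominated by the norm.\<close>
    have "(\<Sum>\<eta>\<leftarrow>\<psi>s. \<bar>blinfun_apply (\<phi> \<eta>) x\<bar>) \<le> (\<Sum>\<eta>\<leftarrow>\<psi>s. \<eta> \<bar>T x\<bar> * inverse K)"
      using K(1) pos by (intro sum_list_mono)
        (auto simp: \<phi>_apply abs_mult divide_inverse intro!: mult_right_mono positive_functional_abs_le)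
    also have "\<dots> = \<psi> \<bar>T x\<bar> * inverse K" by (simp add: sum_list_mult_const \<psi>s)
    also have "\<dots> \<le> norm (T x) * inverse K"
      using \<psi>(2)[of "\<bar>T x\<bar>"] K(1) by (intro mult_right_mono) (simp_all add: norm_abs_lattice)
    also have "\<dots> \<le> norm x" using K(1) K(2)[of x] by (simp add: field_simps)
    finally show ?thesis using that by simp
  qed
  then have adm: "map \<phi> \<psi>s \<in> admissible" by (simp add: admissible_def comp_def)
  have "norm u = (\<Sum>\<eta>\<leftarrow>\<psi>s. \<eta> \<bar>u\<bar>)" using \<psi>(3) \<psi>s[of "\<bar>u\<bar>"] by simp
  also have "\<dots> = (\<Sum>\<eta>\<leftarrow>\<psi>s. K * \<bar>H0_apply f (\<phi> \<eta>)\<bar>)"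
  proof (intro arg_cong[of _ _ sum_list] map_cong refl)
    fix \<eta> assume \<eta>: "\<eta> \<in> set \<psi>s"
    have "H0_apply f (\<phi> \<eta>) = inverse K * \<eta> u"
      using pairing_compatibleD[OF compat pos[OF \<eta>] bl[OF \<eta>]] sd[OF \<eta>] K(1) ws by (simp add: \<phi>_def H0_apply_scale)
    then show "\<eta> \<bar>u\<bar> = K * \<bar>H0_apply f (\<phi> \<eta>)\<bar>"
      using sign_definite_abs[OF pos[OF \<eta>] sd[OF \<eta>]] K(1) by (simp add: abs_mult)
  qed
  also have "\<dots> = K * (\<Sum>\<phi>\<leftarrow>map \<phi> \<psi>s. \<bar>H0_apply f \<phi>\<bar>)"
    by (simp add: sum_list_const_mult comp_def)
  also have "\<dots> \<le> K * norm f" using K(1) adm by (intro mult_left_mono H0_sum_le_norm) auto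
  finally show ?thesis .
qed

section \<open>The closure of the graph\<close>

lemma tendsto_pprt:
  fixes g :: "'c \<Rightarrow> 'a::banach_lattice"
  shows "(g \<longlongrightarrow> l) F \<Longrightarrow> ((\<lambda>x. pprt (g x)) \<longlongrightarrow> pprt l) F"
  using continuous_on_tendsto_compose[OF continuous_pprt[of UNIV], of g l F] by simp

lemma subspace_closure_extension_graph: "subspace (closure (extension_graph T))"
  unfolding subspace_def
proof (intro conjI ballI allI)
  \<comment> \<open>The zero pair is obtained by scaling a generator, since \<open>T 0 = 0\<close>
    is not among the hypotheses.\<close>
  have "0 *\<^sub>R (delta_H0 0, T 0) \<in> extension_graph T"
    by (intro extension_graph.scale extension_graph.delta)
  then have "0 \<in> extension_graph T" by (simp only: scaleR_zero_left)
  then show "0 \<in> closure (extension_graph T)" by (rule closure_subset[THEN subsetD])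
  fix p q c assume "p \<in> closure (extension_graph T)"
  then obtain P where P: "\<And>n. P n \<in> extension_graph T" "P \<longlonglongrightarrow> p"
    by (auto simp: closure_sequential)
  show "c *\<^sub>R p \<in> closure (extension_graph T)"
    unfolding closure_sequential using P
    by (intro exI[of _ "\<lambda>n. c *\<^sub>R P n"]) (auto intro: extension_graph.scale tendsto_intros)
  assume "q \<in> closure (extension_graph T)"
  then obtain Q where Q: "\<And>n. Q n \<in> extension_graph T" "Q \<longlonglongrightarrow> q"
    by (auto simp: closure_sequential)
  show "p + q \<in> closure (extension_graph T)"
    unfolding closure_sequential using P Q
    by (intro exI[of _ "\<lambda>n. P n + Q n"]) (auto intro: extension_graph.add tendsto_intros)
qed

lemma closure_extension_graph_pprt:
  assumes "(f, u) \<in> closure (extension_graph T)"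
  shows "(pprt f, pprt u) \<in> closure (extension_graph T)"
proof -
  obtain P where P: "\<And>n. P n \<in> extension_graph T" "P \<longlonglongrightarrow> (f, u)"
    using assms by (auto simp: closure_sequential)
  have "(\<lambda>n. (pprt (fst (P n)), pprt (snd (P n)))) \<longlonglongrightarrow> (pprt f, pprt u)"
    using tendsto_fst[OF P(2)] tendsto_snd[OF P(2)] by (intro tendsto_Pair tendsto_pprt) simp_all
  moreover have "(pprt (fst (P n)), pprt (snd (P n))) \<in> extension_graph T" for n
    using P(1)[of n] by (intro extension_graph.pprt) simp
  ultimately show ?thesis unfolding closure_sequential by (intro exI conjI allI)
qed

lemma closure_extension_graph_norm_le:
  fixes T :: "'a::banach \<Rightarrow> 'b::banach_lattice"
  assumes "(f, u) \<in> closure (extension_graph T)" and T: "bounded_linear T"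
    and K: "0 < K" "\<And>x. norm (T x) \<le> K * norm x"
  shows "norm u \<le> K * norm f"
proof -
  have "closed {p :: 'a H0 \<times> 'b. norm (snd p) \<le> K * norm (fst p)}"
    by (rule closed_Collect_le) (intro continuous_intros)+
  then have "closure (extension_graph T) \<subseteq> {p. norm (snd p) \<le> K * norm (fst p)}"
  proof (rule closure_minimal[rotated])
    show "extension_graph T \<subseteq> {p. norm (snd p) \<le> K * norm (fst p)}"
    proof
      fix p assume "p \<in> extension_graph T"
      then show "p \<in> {p. norm (snd p) \<le> K * norm (fst p)}"
        using extension_graph_norm_le[OF _ T K, of "fst p" "snd p"] by simp
    qed
  qed
  from subsetD[OF this assms(1)] show ?thesis by simp
qed

lemma sublattice_if_pprt:
  assumes "subspace Y" "closed Y" "\<And>y. y \<in> Y \<Longrightarrow> pprt y \<in> Y"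
  shows "sublattice Y"
  using assms unfolding sublattice_def
  by (auto simp: sup_eq_pprt inf_eq_pprt intro!: subspace_add subspace_diff)

text \<open>Closedness is the point: along a convergent sequence in the domain, the norm estimate
  makes the partners Cauchy, and their limit is a partner of the limit.\<close>

lemma sublattice_extension_domain:
  assumes T: "bounded_linear T" and K: "0 < K" "\<And>x. norm (T x) \<le> K * norm x"
  shows "sublattice (fst ` closure (extension_graph T))"
proof (rule sublattice_if_pprt)
  let ?R = "closure (extension_graph T)"
  show "subspace (fst ` ?R)"
    by (intro linear_subspace_image subspace_closure_extension_graph bounded_linear.linear
        bounded_linear_fst)
  show "pprt y \<in> fst ` ?R" if "y \<in> fst ` ?R" for y
  proof -
    from that obtain u where "(y, u) \<in> ?R" by auto
    from imageI[OF closure_extension_graph_pprt[OF this], of fst] show ?thesis by simp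
  qed
  show "closed (fst ` ?R)"
    unfolding closed_sequential_limits
  proof (intro allI impI, elim conjE)
    fix F l assume F: "\<forall>n. F n \<in> fst ` ?R" "F \<longlonglongrightarrow> l"
    have "\<exists>u. (F n, u) \<in> ?R" for n using F(1)[rule_format, of n] by auto
    then obtain U where U: "\<And>n. (F n, U n) \<in> ?R" by metis
    have le: "norm (U m - U n) \<le> K * norm (F m - F n)" for m n
    proof (rule closure_extension_graph_norm_le[OF _ T K])
      show "(F m - F n, U m - U n) \<in> ?R"
        using subspace_diff[OF subspace_closure_extension_graph U[of m] U[of n]] by simp
    qed
    have "Cauchy U"
    proof (rule CauchyI)
      fix e :: real assume "0 < e"
      with K(1) have "0 < e / K" by simp
      from CauchyD[OF LIMSEQ_imp_Cauchy[OF F(2)] this] obtain M where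
        M: "\<And>m n. m \<ge> M \<Longrightarrow> n \<ge> M \<Longrightarrow> norm (F m - F n) < e / K" by blast
      have "norm (U m - U n) < e" if "m \<ge> M" "n \<ge> M" for m n
        using le[of m n] M[OF that] K(1) by (simp add: field_simps)
      then show "\<exists>M. \<forall>m\<ge>M. \<forall>n\<ge>M. norm (U m - U n) < e" by blast
    qed
    then obtain u where "U \<longlonglongrightarrow> u" using Cauchy_convergent convergent_def by blast
    with F(2) have "(\<lambda>n. (F n, U n)) \<longlonglongrightarrow> (l, u)" by (intro tendsto_Pair)
    with U have "(l, u) \<in> ?R" by (rule closed_sequentially[OF closed_closure])
    then show "l \<in> fst ` ?R" by (metis fst_conv imageI)
  qed
qed

section \<open>Existence and uniqueness of the extension\<close>

lemma lattice_hom_pprt: "lattice_hom h \<Longrightarrow> h (pprt x) = pprt (h x)"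
  by (simp add: lattice_hom_def pprt_def linear_0 bounded_linear.linear)

lemma lattice_hom_if_pprt:
  assumes "bounded_linear h" "\<And>x. h (pprt x) = pprt (h x)"
  shows "lattice_hom h"
proof -
  have lin: "linear h" using assms(1) by (rule bounded_linear.linear)
  show ?thesis
    using assms unfolding lattice_hom_def
    by (simp add: sup_eq_pprt inf_eq_pprt linear_add[OF lin] linear_diff[OF lin])
qed

lemma lattice_hom_comp: "lattice_hom g \<Longrightarrow> lattice_hom h \<Longrightarrow> lattice_hom (g \<circ> h)"
  unfolding lattice_hom_def using bounded_linear_compose[of g h] by (simp add: comp_def)

text \<open>The domain of the closed graph is a closed sublattice containing the generators, hence
  contains the whole hull.\<close>

lemma FBL_extension_exists:
  fixes T :: "'a::banach \<Rightarrow> 'b::banach_lattice"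
  assumes T: "bounded_linear T"
  shows "\<exists>h. lattice_hom h \<and> h \<circ> delta_FBL = T"
proof -
  let ?R = "closure (extension_graph T)"
  obtain K where K: "0 < K" "\<And>x. norm (T x) \<le> K * norm x"
    using bounded_linear.pos_bounded[OF T] by (auto simp: mult.commute)
  note sub = subspace_closure_extension_graph[of T]
  note le = closure_extension_graph_norm_le[OF _ T K]
  have delta: "(delta_H0 x, T x) \<in> ?R" for x
    using closure_subset extension_graph.delta[of x T] by blast
  then have "sublattice hull range delta_H0 \<subseteq> fst ` ?R"
    by (intro hull_minimal sublattice_extension_domain[OF T K]) force
  then have "\<exists>u. (Rep_FBL f, u) \<in> ?R" for f using Rep_FBL[of f] by force
  then obtain h where h: "\<And>f. (Rep_FBL f, h f) \<in> ?R" by metis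
  \<comment> \<open>The difference of two partners of \<open>f\<close> is a partner of 0, so the
    estimate bounds its norm by 0.\<close>
  have unique: "u = h f" if "(Rep_FBL f, u) \<in> ?R" for f u
    using le[of 0 "u - h f"] subspace_diff[OF sub that h[of f]] by simp
  have "bounded_linear h"
  proof (rule bounded_linear_intro)
    show "h (f + g) = h f + h g" for f g
      using subspace_add[OF sub h[of f] h[of g]] by (intro unique[symmetric]) (simp add: plus_FBL.rep_eq)
    show "h (c *\<^sub>R f) = c *\<^sub>R h f" for c f
      using subspace_scale[OF sub h[of f], of c] by (intro unique[symmetric]) (simp add: scaleR_FBL.rep_eq)
    show "norm (h f) \<le> norm f * K" for f
      using le[OF h[of f]] by (simp add: norm_FBL.rep_eq mult.commute)
  qed
  moreover have "h (pprt f) = pprt (h f)" for f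
    using closure_extension_graph_pprt[OF h[of f]]
    by (intro unique[symmetric]) (simp add: pprt_def sup_FBL.rep_eq zero_FBL.rep_eq)
  ultimately have "lattice_hom h" by (rule lattice_hom_if_pprt)
  moreover have "h (delta_FBL x) = T x" for x
    using delta[of x] by (intro unique[symmetric]) (simp add: delta_FBL.rep_eq)
  ultimately show ?thesis by (auto simp: fun_eq_iff)
qed

text \<open>The set where \<open>g\<close> and \<open>h\<close> agree is a closed sublattice
  containing the generators. The argument takes place in \<open>H0\<close>, where the hull is
  formed.\<close>

lemma FBL_hom_eqI:
  fixes g h :: "'a::banach FBL \<Rightarrow> 'b::banach_lattice"
  assumes g: "lattice_hom g" and h: "lattice_hom h" and eq: "g \<circ> delta_FBL = h \<circ> delta_FBL"
  shows "g = h"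
proof -
  have blg: "bounded_linear g" and blh: "bounded_linear h"
    using g h by (simp_all add: lattice_hom_def)
  note lin = blg[THEN bounded_linear.linear] blh[THEN bounded_linear.linear]
  define Z where "Z = Rep_FBL ` {f. g f = h f}"
  have "sublattice Z"
  proof (rule sublattice_if_pprt)
    have linear_Rep: "linear (Rep_FBL :: 'a FBL \<Rightarrow> 'a H0)"
      by (rule linearI) (simp_all add: plus_FBL.rep_eq scaleR_FBL.rep_eq)
    have sub: "subspace {f. g f = h f}"
      using lin by (simp add: subspace_def linear_0 linear_add linear_scale)
    with linear_Rep show "subspace Z" unfolding Z_def by (rule linear_subspace_image)
    have "pprt (Rep_FBL f) = Rep_FBL (pprt f)" for f :: "'a FBL"
      by (simp add: pprt_def sup_FBL.rep_eq zero_FBL.rep_eq)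
    then show "pprt y \<in> Z" if "y \<in> Z" for y
      using that lattice_hom_pprt[OF g] lattice_hom_pprt[OF h] by (auto simp: Z_def)
    \<comment> \<open>Closedness is transferred to \<open>H0\<close> as completeness, which the
      isometry \<open>Rep_FBL\<close> preserves.\<close>
    have "complete {f. g f = h f}"
      using blg blh by (simp add: complete_eq_closed closed_Collect_eq linear_continuous_on)
    moreover have "bounded_linear (Rep_FBL :: 'a FBL \<Rightarrow> 'a H0)"
      using linear_Rep by (auto simp: bounded_linear_def bounded_linear_axioms_def norm_FBL.rep_eq
          intro: exI[of _ 1])
    ultimately have "complete Z"
      unfolding Z_def using sub by (intro complete_isometric_image[of 1]) (simp_all add: norm_FBL.rep_eq)
    then show "closed Z" by (simp add: complete_eq_closed)
  qed
  moreover have "range delta_H0 \<subseteq> Z"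
  proof
    fix z :: "'a H0" assume "z \<in> range delta_H0"
    then obtain x where "z = Rep_FBL (delta_FBL x)" by (auto simp: delta_FBL.rep_eq)
    then show "z \<in> Z" using fun_cong[OF eq, of x] by (simp add: Z_def)
  qed
  ultimately have "sublattice hull range delta_H0 \<subseteq> Z" by (intro hull_minimal)
  then have "Rep_FBL f \<in> Z" for f using Rep_FBL[of f] by blast
  then have "g f = h f" for f unfolding Z_def by (metis (mono_tags) Rep_FBL_inject imageE mem_Collect_eq)
  then show ?thesis by blast
qed

lemma beta_FBL:
  "lattice_hom (beta_FBL :: 'a::banach_lattice FBL \<Rightarrow> 'a)"
  "beta_FBL \<circ> delta_FBL = (id :: 'a \<Rightarrow> 'a)"
proof -
  have "\<exists>!\<beta> :: 'a FBL \<Rightarrow> 'a. lattice_hom \<beta> \<and> \<beta> \<circ> delta_FBL = id"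
  proof (rule ex_ex1I)
    show "\<exists>\<beta> :: 'a FBL \<Rightarrow> 'a. lattice_hom \<beta> \<and> \<beta> \<circ> delta_FBL = id"
      using bounded_linear_ident unfolding id_def by (rule FBL_extension_exists)
  qed (auto intro: FBL_hom_eqI)
  from theI'[OF this] show "lattice_hom (beta_FBL :: 'a FBL \<Rightarrow> 'a)"
    "beta_FBL \<circ> delta_FBL = (id :: 'a \<Rightarrow> 'a)" by (simp_all add: beta_FBL_def)
qed

lemma beta_FBL_delta: "beta_FBL (delta_FBL x) = x"
  using fun_cong[OF beta_FBL(2), of x] by simp

lemma bounded_linear_delta_FBL: "bounded_linear (delta_FBL :: 'a::banach \<Rightarrow> 'a FBL)"
proof (rule bounded_linear_intro)
  show "delta_FBL (x + y) = delta_FBL x + delta_FBL y" for x y :: 'a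
    by (simp add: Rep_FBL_inject[symmetric] H0_apply_inject[symmetric] fun_eq_iff delta_FBL.rep_eq
        plus_FBL.rep_eq plus_H0.rep_eq delta_H0.rep_eq blinfun.add_right)
  show scale: "delta_FBL (c *\<^sub>R x) = c *\<^sub>R delta_FBL x" for c and x :: 'a
    by (simp add: Rep_FBL_inject[symmetric] H0_apply_inject[symmetric] fun_eq_iff delta_FBL.rep_eq
        scaleR_FBL.rep_eq scaleR_H0.rep_eq delta_H0.rep_eq blinfun.scaleR_right)
  \<comment> \<open>On the unit ball this is the defining condition of
    \<open>admissible\<close>.\<close>
  have unit: "norm (delta_FBL x) \<le> 1" if "norm x \<le> 1" for x :: 'a
    using that
    by (simp add: norm_FBL.rep_eq delta_FBL.rep_eq H0_norm_le_iff delta_H0.rep_eq admissible_def)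
  show "norm (delta_FBL x) \<le> norm x * 1" for x :: 'a
  proof (cases "x = 0")
    case True
    then show ?thesis using scale[of 0 x] by simp
  next
    case False
    then show ?thesis using unit[of "x /\<^sub>R norm x"] by (simp add: scale field_simps)
  qed
qed

lemma lattice_hom_continuous_on: "lattice_hom h \<Longrightarrow> continuous_on A h"
  by (simp add: lattice_hom_def linear_continuous_on)

section \<open>Liftings and complemented sublattices\<close>

text \<open>\<open>range T\<close> is the fixed-point set of the projection
  \<open>T \<circ> \<beta>\<close>, hence closed, and \<open>\<beta>\<close> provides the continuous
  inverse of \<open>T\<close>.\<close>

lemma lifting_imp_complemented:
  fixes T :: "'a::banach_lattice \<Rightarrow> 'a FBL"
  assumes T: "lattice_hom T" and \<beta>: "lattice_hom \<beta>" and id: "\<And>x. \<beta> (T x) = x"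
  shows "sublattice (range T)" "lattice_complemented (range T)"
    "lattice_isomorphic_onto TYPE('a) (range T)"
proof -
  have lin: "linear T" using T by (simp add: lattice_hom_def bounded_linear.linear)
  have range: "range T = {y. T (\<beta> y) = y}" by (auto simp: id) (metis rangeI)
  show "sublattice (range T)"
  proof (rule sublattice_if_pprt)
    show "subspace (range T)" using lin by (rule linear_subspace_image) simp
    show "closed (range T)"
      unfolding range using lattice_hom_continuous_on[OF lattice_hom_comp[OF T \<beta>]]
      by (intro closed_Collect_eq) (simp_all add: comp_def)
    show "pprt y \<in> range T" if "y \<in> range T" for y
      using that by (auto simp flip: lattice_hom_pprt[OF T])
  qed
  show "lattice_complemented (range T)"
    unfolding lattice_complemented_def using lattice_hom_comp[OF T \<beta>] id
    by (intro exI[of _ "T \<circ> \<beta>"]) auto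
  have "homeomorphism UNIV (range T) T \<beta>"
    using id lattice_hom_continuous_on[OF T] lattice_hom_continuous_on[OF \<beta>]
    by (auto simp: homeomorphism_def image_image)
  with T show "lattice_isomorphic_onto TYPE('a) (range T)"
    unfolding lattice_isomorphic_onto_def by blast
qed

text \<open>Needed because a homeomorphism provides continuity of the inverse rather than a norm
  bound.\<close>

lemma bounded_linear_if_continuous:
  fixes f :: "'a::real_normed_vector \<Rightarrow> 'b::real_normed_vector"
  assumes lin: "linear f" and cont: "continuous_on UNIV f"
  shows "bounded_linear f"
proof -
  obtain d where d: "0 < d" "\<And>x. norm x < d \<Longrightarrow> norm (f x) < 1"
    using cont linear_0[OF lin] unfolding continuous_on_iff by (metis UNIV_I dist_0_norm dist_commute zero_less_one)
  show ?thesis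
  proof (rule bounded_linear_intro)
    show "f (x + y) = f x + f y" "f (c *\<^sub>R x) = c *\<^sub>R f x" for x y c
      by (simp_all add: linear_add[OF lin] linear_scale[OF lin])
    show "norm (f x) \<le> norm x * (2 / d)" for x
    proof (cases "x = 0")
      case True
      then show ?thesis by (simp add: linear_0[OF lin])
    next
      case False
      then have "norm (f ((d / (2 * norm x)) *\<^sub>R x)) < 1" using d(1) by (intro d(2)) simp
      then show ?thesis using False d(1) by (simp add: linear_scale[OF lin] field_simps)
    qed
  qed
qed

text \<open>Take \<open>Q = R \<circ> P\<close>. As \<open>S \<circ> Q = P\<close> and
  \<open>S\<close> is injective, \<open>Q\<close> inherits linearity and compatibility with
  \<open>pprt\<close> from \<open>S\<close> and \<open>P\<close>.\<close>

lemma isomorphic_complemented_imp_retract: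
  fixes Y :: "'b::banach_lattice set"
  assumes "lattice_complemented Y" "lattice_isomorphic_onto TYPE('a::banach_lattice) Y"
  obtains S :: "'a::banach_lattice \<Rightarrow> 'b" and Q where "lattice_hom S" "lattice_hom Q" "Q \<circ> S = id"
proof -
  obtain P :: "'b \<Rightarrow> 'b" where P: "lattice_hom P" "range P \<subseteq> Y" "\<And>y. y \<in> Y \<Longrightarrow> P y = y"
    using assms(1) by (auto simp: lattice_complemented_def)
  obtain S :: "'a \<Rightarrow> 'b" and R where S: "lattice_hom S" and hom: "homeomorphism UNIV Y S R"
    using assms(2) by (auto simp: lattice_isomorphic_onto_def)
  have RS: "R (S x) = x" for x using hom by (simp add: homeomorphism_def)
  have SR: "S (R y) = y" if "y \<in> Y" for y using hom that by (simp add: homeomorphism_def)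
  have SY: "S x \<in> Y" for x using hom by (auto simp: homeomorphism_def)
  define Q where "Q = R \<circ> P"
  have SQ: "S (Q z) = P z" for z using P(2) by (auto simp: Q_def intro: SR)
  have inj: "x = y" if "S x = S y" for x y using that RS by metis
  have linS: "linear S" and linP: "linear P"
    using S P(1) by (simp_all add: lattice_hom_def bounded_linear.linear)
  have "linear Q"
    by (rule linearI; rule inj)
      (simp_all add: SQ linear_add[OF linS] linear_scale[OF linS] linear_add[OF linP] linear_scale[OF linP])
  moreover have "continuous_on UNIV Q"
    unfolding Q_def using hom P(2)
    by (intro continuous_on_compose lattice_hom_continuous_on[OF P(1)])
      (auto simp: homeomorphism_def intro: continuous_on_subset)
  ultimately have "bounded_linear Q" by (rule bounded_linear_if_continuous)
  then have "lattice_hom Q"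
    by (rule lattice_hom_if_pprt, intro inj) (simp add: SQ lattice_hom_pprt[OF S] lattice_hom_pprt[OF P(1)])
  moreover have "Q \<circ> S = id" using P(3)[OF SY] RS by (simp add: Q_def fun_eq_iff)
  ultimately show ?thesis using S by (intro that)
qed

text \<open>\<open>delta_FBL\<close> is a linear right inverse of \<open>beta_FBL\<close>, so
  freeness of \<open>'b FBL\<close> lifts \<open>Q\<close> to a lattice homomorphism
  \<open>U\<close> with \<open>beta_FBL \<circ> U = Q\<close>; uniqueness of extensions proves this
  equation.\<close>

lemma retract_of_FBL_lifting:
  fixes S :: "'a::banach_lattice \<Rightarrow> 'b::banach FBL"
  assumes S: "lattice_hom S" and Q: "lattice_hom Q" and QS: "Q \<circ> S = id"
  shows "lattice_lifting_property TYPE('a)"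
proof -
  have "bounded_linear (\<lambda>x. delta_FBL (Q (delta_FBL x)))"
    using Q by (intro bounded_linear_compose[OF bounded_linear_delta_FBL]
        bounded_linear_compose[OF _ bounded_linear_delta_FBL]) (simp add: lattice_hom_def)
  from FBL_extension_exists[OF this] obtain U :: "'b FBL \<Rightarrow> 'a FBL"
    where U: "lattice_hom U" and "U \<circ> delta_FBL = (\<lambda>x. delta_FBL (Q (delta_FBL x)))" by blast
  then have U_delta: "U (delta_FBL x) = delta_FBL (Q (delta_FBL x))" for x
    by (simp add: fun_eq_iff)
  have "beta_FBL \<circ> U = Q"
    using lattice_hom_comp[OF beta_FBL(1) U] Q
    by (rule FBL_hom_eqI) (simp add: fun_eq_iff U_delta beta_FBL_delta)
  then have "beta_FBL \<circ> (U \<circ> S) = id" using QS by (simp flip: comp_assoc)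
  with lattice_hom_comp[OF U S] show ?thesis unfolding lattice_lifting_property_def by blast
qed

theorem corollary2p8:
  shows "lattice_lifting_property TYPE('a::banach_lattice) \<longleftrightarrow>
    (\<exists>Y :: 'a FBL set. sublattice Y \<and> lattice_complemented Y \<and> lattice_isomorphic_onto TYPE('a) Y)"
proof
  assume "lattice_lifting_property TYPE('a)"
  then obtain T :: "'a \<Rightarrow> 'a FBL" where "lattice_hom T" "beta_FBL \<circ> T = id"
    unfolding lattice_lifting_property_def by blast
  then have "lattice_hom T" "beta_FBL (T x) = x" for x by (simp_all add: fun_eq_iff)
  from lifting_imp_complemented[OF this(1) beta_FBL(1) this(2)]
  show "\<exists>Y :: 'a FBL set. sublattice Y \<and> lattice_complemented Y \<and> lattice_isomorphic_onto TYPE('a) Y"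
    by blast
next
  assume "\<exists>Y :: 'a FBL set. sublattice Y \<and> lattice_complemented Y \<and> lattice_isomorphic_onto TYPE('a) Y"
  then obtain Y :: "'a FBL set" where "lattice_complemented Y" "lattice_isomorphic_onto TYPE('a) Y"
    by blast
  from isomorphic_complemented_imp_retract[OF this] show "lattice_lifting_property TYPE('a)"
    using retract_of_FBL_lifting by blast
qed

end
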